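(* Let $\mathbb{K}$ be a field. For each element $q \in \mathbb{K}^\times$ and $\lambda(\gamma,\gamma') = q^{\gamma_1\gamma_2' - \gamma_2\gamma_1'}$ for $\gamma,\gamma' \in \mathbb{Z}^2$, the exact sequence of groups $$ \mathbf 1 \to \operatorname{Hom}(\mathbb{Z}^2,\mathbb{K}^\times) \to \operatorname{Aut}(A_q) \to \operatorname{Aut}(\mathbb{Z}^2,\lambda) \to \mathbf 1 $$ splits. For $q^2 = 1$ (where $\operatorname{Aut}(\mathbb{Z}^2,\lambda)=\operatorname{GL}_2(\mathbb{Z})$), the homomorphisms $\sigma : \operatorname{GL}_2(\mathbb{Z}) \to \operatorname{Aut}(A_q)$ splitting the sequence are parametrized by the abelian group $$ Z^1(\operatorname{GL}_2(\mathbb{Z}), \operatorname{Hom}(\mathbb{Z}^2,\mathbb{K}^\times)) \cong \{ (r_0,r_1,r_2) \in (\mathbb{K}^\times)^3 : r_2^4 r_0^2 = r_1^2 \}, $$ and for $q^2 \neq 1$ (where $\operatorname{Aut}(\mathbb{Z}^2,\lambda)=\operatorname{SL}_2(\mathbb{Z})$), the homomorphisms $\sigma : \operatorname{SL}_2(\mathbb{Z}) \to \operatorname{Aut}(A_q)$ splitting the sequence are parametrized by $$ Z^1(\operatorname{SL}_2(\mathbb{Z}), \operatorname{Hom}(\mathbb{Z}^2,\mathbb{K}^\times)) \cong (\mathbb{K}^\times)^2 \times \{ z \in \mathbb{K}^\times : z^2 = 1 \}. $$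
   Context: For $q \in \mathbb{K}^\times$, $A_q$ is the unital associative $\mathbb{K}$-algebra with basis $(\delta_\gamma)_{\gamma\in\mathbb{Z}^2}$ and multiplication $\delta_\gamma\delta_{\gamma'} = q^{\gamma_1\gamma_2'}\delta_{\gamma+\gamma'}$; equivalently it is generated by $u_1 = \delta_{(1,0)}$, $u_2=\delta_{(0,1)}$ and their inverses subject to $u_1u_2 = qu_2u_1$. $\operatorname{Aut}(A_q)$ is the group of $\mathbb{K}$-algebra automorphisms. Every $\varphi \in \operatorname{Aut}(A_q)$ is graded: there is a unique $\varphi_\Gamma \in \operatorname{Aut}(\mathbb{Z}^2) \cong \operatorname{GL}_2(\mathbb{Z})$ with $\varphi(\mathbb{K}\delta_\gamma) = \mathbb{K}\delta_{\varphi_\Gamma(\gamma)}$ for all $\gamma\in\mathbb{Z}^2$. The group $\operatorname{Aut}(\mathbb{Z}^2,\lambda)$ consists of the $\psi\in\operatorname{Aut}(\mathbb{Z}^2)$ with $\lambda(\psi(\gamma),\psi(\gamma'))=\lambda(\gamma,\gamma')$ for all $\gamma,\gamma'$. In the exact sequence, the map $\operatorname{Aut}(A_q)\to\operatorname{Aut}(\mathbb{Z}^2,\lambda)$ is $\varphi\mapsto\varphi_\Gamma$, and $\chi \in \operatorname{Hom}(\mathbb{Z}^2,\mathbb{K}^\times)$ is mapped to the automorphism $\delta_\gamma\mapsto\chi(\gamma)\delta_\gamma$. For a group $G$ and an (abelian) $G$-module $M$ (written additively), $Z^1(G,M) = \{ f : G\to M : f(xy) = f(x) + x.f(y) \text{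 for all } x,y\in G\}$ is the group of $1$-cocycles. Here $\operatorname{Aut}(\mathbb{Z}^2,\lambda)$ acts on $\operatorname{Hom}(\mathbb{Z}^2,\mathbb{K}^\times)$ via conjugation in $\operatorname{Aut}(A_q)$, i.e. $g.\chi = \chi\circ g^{-1}$. The parametrization of splittings is obtained by fixing one homomorphic section $\sigma_0$; any other homomorphic section is of the form $\sigma = f\cdot\sigma_0$ with $f$ a unique element of $Z^1(\operatorname{Aut}(\mathbb{Z}^2,\lambda),\operatorname{Hom}(\mathbb{Z}^2,\mathbb{K}^\times))$. *)

theory Defs
  imports
    "HOL-Analysis.Determinants"
    "HOL-Library.Poly_Mapping"
    "HOL-Algebra.Bij"
    "HOL-Algebra.Coset"
    "HOL-Algebra.Module"
begin

text \<open>The lattice \<open>\<int>\<^sup>2\<close> is the type \<open>int^2\<close>; a field is a type of class \<open>field\<close>.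
  Groups are records in the style of \<open>HOL-Algebra\<close>.\<close>

definition Z2 :: "(int^2) monoid" where
  "Z2 = \<lparr>carrier = UNIV, mult = (+), one = 0\<rparr>"

definition unit_group :: "'k::field monoid" where
  "unit_group = \<lparr>carrier = {x. x \<noteq> 0}, mult = (*), one = 1\<rparr>"

definition char_group :: "(int^2 \<Rightarrow> 'k::field) monoid" where
  "char_group =
    \<lparr>carrier = hom Z2 unit_group, mult = (\<lambda>\<theta> \<theta>' \<gamma>. \<theta> \<gamma> * \<theta>' \<gamma>), one = (\<lambda>_. 1)\<rparr>"


section \<open>The quantum torus and its automorphisms\<close>

definition delta :: "int^2 \<Rightarrow> (int^2 \<Rightarrow>\<^sub>0 'k::field)" where
  "delta \<gamma> = Poly_Mapping.single \<gamma> 1"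

text \<open>Elements are finitely supported functions on \<open>\<int>\<^sup>2\<close>, so \<^const>\<open>delta\<close> is a basis. The product
  below is the bilinear extension of \<open>\<delta>\<^sub>\<gamma> \<delta>\<^sub>\<gamma>\<^sub>' = q\<^bsup>\<gamma>\<^sub>1\<gamma>\<^sub>2'\<^esup> \<delta>\<^sub>\<gamma>\<^sub>+\<^sub>\<gamma>\<^sub>'\<close>; it is not the multiplication that
  \<open>HOL-Library.Poly_Mapping\<close> puts on the same type (the two agree for \<open>q = 1\<close>).\<close>

definition qt_mult ::
    "'k::field \<Rightarrow> (int^2 \<Rightarrow>\<^sub>0 'k) \<Rightarrow> (int^2 \<Rightarrow>\<^sub>0 'k) \<Rightarrow> (int^2 \<Rightarrow>\<^sub>0 'k)" where
  "qt_mult q a b =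
    (\<Sum>\<gamma>\<in>Poly_Mapping.keys a. \<Sum>\<gamma>'\<in>Poly_Mapping.keys b.
       Poly_Mapping.single (\<gamma> + \<gamma>')
         (Poly_Mapping.lookup a \<gamma> * Poly_Mapping.lookup b \<gamma>' * q powi (\<gamma> $ 1 * \<gamma>' $ 2)))"

definition quantum_torus :: "'k::field \<Rightarrow> ('k, int^2 \<Rightarrow>\<^sub>0 'k) module" where
  "quantum_torus q =
    \<lparr>carrier = UNIV, mult = qt_mult q, one = delta 0, zero = 0, add = (+),
     smult = (\<lambda>c. Poly_Mapping.map ((*) c))\<rparr>"

lemma delta_mult:
  "delta \<gamma> \<otimes>\<^bsub>quantum_torus q\<^esub> delta \<gamma>'
     = (q powi (\<gamma> $ 1 * \<gamma>' $ 2)) \<odot>\<^bsub>quantum_torus q\<^esub> delta (\<gamma> + \<gamma>')"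
  by (simp add: quantum_torus_def qt_mult_def delta_def map_single)

definition Aut_qt :: "'k::field \<Rightarrow> ((int^2 \<Rightarrow>\<^sub>0 'k) \<Rightarrow> (int^2 \<Rightarrow>\<^sub>0 'k)) monoid" where
  "Aut_qt q = BijGroup (carrier (quantum_torus q))
     \<lparr>carrier := {\<phi> \<in> ring_hom (quantum_torus q) (quantum_torus q) \<inter> Bij (carrier (quantum_torus q)).
        \<forall>c a. \<phi> (c \<odot>\<^bsub>quantum_torus q\<^esub> a) = c \<odot>\<^bsub>quantum_torus q\<^esub> \<phi> a}\<rparr>"

definition lam :: "'k::field \<Rightarrow> int^2 \<Rightarrow> int^2 \<Rightarrow> 'k" where
  "lam q \<gamma> \<gamma>' = q powi (\<gamma> $ 1 * \<gamma>' $ 2 - \<gamma> $ 2 * \<gamma>' $ 1)"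

definition Aut_lam :: "'k::field \<Rightarrow> (int^2 \<Rightarrow> int^2) monoid" where
  "Aut_lam q = AutoGroup Z2
     \<lparr>carrier := {\<psi> \<in> auto Z2. \<forall>\<gamma> \<gamma>'. lam q (\<psi> \<gamma>) (\<psi> \<gamma>') = lam q \<gamma> \<gamma>'}\<rparr>"

text \<open>The automorphism \<open>\<delta>\<^sub>\<gamma> \<mapsto> \<theta>(\<gamma>) \<delta>\<^sub>\<gamma>\<close>.\<close>

definition char_aut :: "(int^2 \<Rightarrow> 'k::field) \<Rightarrow> (int^2 \<Rightarrow>\<^sub>0 'k) \<Rightarrow> (int^2 \<Rightarrow>\<^sub>0 'k)" where
  "char_aut \<theta> = Poly_Mapping.mapp (\<lambda>\<gamma> c. \<theta> \<gamma> * c)"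

lemma char_aut_delta:
  "char_aut \<theta> (delta \<gamma>) = \<theta> \<gamma> \<odot>\<^bsub>quantum_torus q\<^esub> delta \<gamma>"
  by (rule poly_mapping_eqI)
     (simp add: char_aut_def delta_def quantum_torus_def lookup_mapp map_single lookup_single when_def)

text \<open>The map \<open>\<phi> \<mapsto> \<phi>\<^sub>\<Gamma>\<close>; here \<open>range (Poly_Mapping.single \<gamma>)\<close> is the line \<open>\<bbbK>\<delta>\<^sub>\<gamma>\<close>.\<close>

definition lattice_part ::
    "((int^2 \<Rightarrow>\<^sub>0 'k::field) \<Rightarrow> (int^2 \<Rightarrow>\<^sub>0 'k)) \<Rightarrow> (int^2 \<Rightarrow> int^2)" where
  "lattice_part \<phi> = (THE \<psi>. \<psi> \<in> auto Z2 \<and>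
     (\<forall>\<gamma>. \<phi> ` range (Poly_Mapping.single \<gamma> :: 'k \<Rightarrow> _) = range (Poly_Mapping.single (\<psi> \<gamma>))))"


section \<open>Integral matrix groups\<close>

definition GL2Z :: "(int^2^2) monoid" where
  "GL2Z = \<lparr>carrier = {A. invertible A}, mult = (**), one = mat 1\<rparr>"

definition SL2Z :: "(int^2^2) monoid" where
  "SL2Z = \<lparr>carrier = {A. det A = 1}, mult = (**), one = mat 1\<rparr>"


section \<open>Exact sequences, cocycles and splittings\<close>

text \<open>The library notion of short exact sequence forces all groups to live on one type.\<close>

definition short_exact ::
    "'a monoid \<Rightarrow> 'b monoid \<Rightarrow> 'c monoid \<Rightarrow> ('a \<Rightarrow> 'b) \<Rightarrow> ('b \<Rightarrow> 'c) \<Rightarrow> bool" where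
  "short_exact N G Q i p \<longleftrightarrow>
     group N \<and> group G \<and> group Q \<and> i \<in> mon N G \<and> p \<in> epi G Q \<and>
     i ` carrier N = kernel G Q p"

text \<open>The module \<open>M\<close> is written multiplicatively, with \<open>act\<close> the action of \<open>G\<close>. Cocycles are extensional
  so that they are determined by their values on \<open>G\<close>.\<close>

definition Z1 :: "'g monoid \<Rightarrow> 'm monoid \<Rightarrow> ('g \<Rightarrow> 'm \<Rightarrow> 'm) \<Rightarrow> ('g \<Rightarrow> 'm) monoid" where
  "Z1 G M act =
    \<lparr>carrier = {f \<in> carrier G \<rightarrow>\<^sub>E carrier M.
        \<forall>x\<in>carrier G. \<forall>y\<in>carrier G. f (x \<otimes>\<^bsub>G\<^esub> y) = f x \<otimes>\<^bsub>M\<^esub> act x (f y)},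
     mult = (\<lambda>f f'. \<lambda>x\<in>carrier G. f x \<otimes>\<^bsub>M\<^esub> f' x),
     one = (\<lambda>x\<in>carrier G. \<one>\<^bsub>M\<^esub>)\<rparr>"

text \<open>In the following, \<open>\<rho>\<close> is the map by which \<open>G\<close> acts on \<open>\<int>\<^sup>2\<close>: the identity for
  \<open>G = Aut(\<int>\<^sup>2,\<lambda>)\<close>, and \<open>(*v)\<close> for a matrix group.\<close>

definition char_act ::
    "'g monoid \<Rightarrow> ('g \<Rightarrow> int^2 \<Rightarrow> int^2) \<Rightarrow> 'g \<Rightarrow> (int^2 \<Rightarrow> 'k::field) \<Rightarrow> (int^2 \<Rightarrow> 'k)" where
  "char_act G \<rho> g \<theta> = \<theta> \<circ> \<rho> (inv\<^bsub>G\<^esub> g)"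

definition char_Z1 ::
    "'g monoid \<Rightarrow> ('g \<Rightarrow> int^2 \<Rightarrow> int^2) \<Rightarrow> ('g \<Rightarrow> int^2 \<Rightarrow> 'k::field) monoid" where
  "char_Z1 G \<rho> = Z1 G char_group (char_act G \<rho>)"

definition splittings ::
    "'k::field \<Rightarrow> 'g monoid \<Rightarrow> ('g \<Rightarrow> int^2 \<Rightarrow> int^2)
      \<Rightarrow> ('g \<Rightarrow> (int^2 \<Rightarrow>\<^sub>0 'k) \<Rightarrow> (int^2 \<Rightarrow>\<^sub>0 'k)) set" where
  "splittings q G \<rho> =
    {\<sigma> \<in> hom G (Aut_qt q) \<inter> extensional (carrier G). \<forall>g\<in>carrier G. lattice_part (\<sigma> g) = \<rho> g}"

text \<open>The product \<open>f\<cdot>\<sigma>\<^sub>0\<close> of a cocycle and a splitting, formed in the automorphism group.\<close>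

definition twist ::
    "'k::field \<Rightarrow> 'g monoid \<Rightarrow> ('g \<Rightarrow> int^2 \<Rightarrow> 'k) \<Rightarrow> ('g \<Rightarrow> (int^2 \<Rightarrow>\<^sub>0 'k) \<Rightarrow> (int^2 \<Rightarrow>\<^sub>0 'k))
      \<Rightarrow> ('g \<Rightarrow> (int^2 \<Rightarrow>\<^sub>0 'k) \<Rightarrow> (int^2 \<Rightarrow>\<^sub>0 'k))" where
  "twist q G f \<sigma>\<^sub>0 = (\<lambda>g\<in>carrier G. char_aut (f g) \<otimes>\<^bsub>Aut_qt q\<^esub> \<sigma>\<^sub>0 g)"

definition GL_params :: "('k::field \<times> 'k \<times> 'k) monoid" where
  "GL_params = (unit_group \<times>\<times> unit_group \<times>\<times> unit_group)
     \<lparr>carrier := {(r\<^sub>0, r\<^sub>1, r\<^sub>2). r\<^sub>0 \<noteq> 0 \<and> r\<^sub>1 \<noteq> 0 \<and> r\<^sub>2 \<noteq> 0 \<and> r\<^sub>2 ^ 4 * r\<^sub>0 ^ 2 = r\<^sub>1 ^ 2}\<rparr>"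

definition SL_params :: "(('k::field \<times> 'k) \<times> 'k) monoid" where
  "SL_params = (unit_group \<times>\<times> unit_group) \<times>\<times> unit_group \<lparr>carrier := {z. z \<noteq> 0 \<and> z ^ 2 = 1}\<rparr>"

end

(*
  In A_q the product of the leading terms of two elements, for any translation invariant order, is
  nonzero. Hence units are monomials and every automorphism is delta_x |-> c(x) delta_(psi x).

  Let Q(x) = x1 x2 + x1 + x2. Modulo 2 this is the quadratic form of Arf invariant 1, which GL_2
  preserves, so the exponent in delta_x |-> q^((Q(A x) - det A Q(x))/2) delta_(A x) is an integer, and
  these automorphisms form a splitting.

  A cocycle f is determined by its values on the generators S, T of SL_2(Z); the relation (ST)^3 = S^2
  leaves free f(S)(e2), f(T)(e2) and the sign f(T)(e1), and on GL_2(Z) the value at the coordinate swap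
  is then forced. Coboundaries realise the first two parameters, an explicit cocycle with values in
  the homomorphisms to {1,-1} the third. On GL_2(Z) the sign is r1 / (r2^2 r0).
*)
theory Submission
  imports Defs
begin

section \<open>Units of the quantum torus\<close>

text \<open>The obvious lift delta_x |-> delta_(A x) is not multiplicative: twice the exponent x1 y2
  is the area form, which A multiplies by det A, plus a symmetric part that A does not respect. With
  a square root p of q, the elements p^(x1 x2) delta_x would multiply by powers of p given by the
  area form alone, and SL_2(Z) would act on them directly. Without a root one must halve a
  difference of quadratic forms over the integers. For x1 x2 alone that difference can be odd; the
  linear terms of Q repair the parity. For cocycles no presentation of SL_2(Z) or GL_2(Z) is proved.
  Generation gives uniqueness, but each admissible triple of values has to be realised by a formula
  valid on the whole group; this is why an explicit cocycle for the sign has to be found. Passing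
  from SL_2(Z) to GL_2(Z) adds no freedom, because conjugating T by the swap leads back into SL_2(Z)
  and thereby fixes the value at the swap. So one parametrization by two units and a sign serves
  both groups, and the triples for GL_2(Z) are a change of coordinates.\<close>

lemma lookup_qt_mult:
  assumes "finite X" "Poly_Mapping.keys a \<subseteq> X"
  shows "Poly_Mapping.lookup (qt_mult q a b) \<gamma> =
    (\<Sum>x\<in>X. Poly_Mapping.lookup a x * Poly_Mapping.lookup b (\<gamma> - x) * q powi (x $ 1 * (\<gamma> - x) $ 2))"
proof -
  let ?t = "\<lambda>x y. Poly_Mapping.lookup a x * Poly_Mapping.lookup b y * q powi (x $ 1 * y $ 2)"
  have inner: "(\<Sum>y\<in>Poly_Mapping.keys b. Poly_Mapping.lookup (Poly_Mapping.single (x + y) (?t x y)) \<gamma>)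
      = ?t x (\<gamma> - x)" for x
  proof -
    have "(\<Sum>y\<in>Poly_Mapping.keys b. Poly_Mapping.lookup (Poly_Mapping.single (x + y) (?t x y)) \<gamma>)
        = (\<Sum>y\<in>Poly_Mapping.keys b. if y = \<gamma> - x then ?t x (\<gamma> - x) else 0)"
      by (rule sum.cong) (auto simp: lookup_single when_def algebra_simps)
    also have "\<dots> = ?t x (\<gamma> - x)"
      by (simp add: sum.delta not_in_keys_iff_lookup_eq_zero)
    finally show ?thesis .
  qed
  have "Poly_Mapping.lookup (qt_mult q a b) \<gamma> = (\<Sum>x\<in>Poly_Mapping.keys a. ?t x (\<gamma> - x))"
    by (simp only: qt_mult_def lookup_sum inner)
  \<comment> \<open>Larger index sets serve \<open>mono_map_mult\<close>, where the support of an
    image is bounded by the image of a support rather than computed.\<close>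
  also have "\<dots> = (\<Sum>x\<in>X. ?t x (\<gamma> - x))"
    using assms by (intro sum.mono_neutral_left) (auto simp: not_in_keys_iff_lookup_eq_zero)
  finally show ?thesis .
qed

text \<open>The order is a relation and not a class instance, so that the lexicographic order and
  its reverse can both be inserted.\<close>

lemma finite_extremal_element:
  assumes "finite S" "S \<noteq> {}"
    and "\<And>x y. x \<noteq> y \<Longrightarrow> L x y \<or> L y x" "\<And>x y z. L x y \<Longrightarrow> L y z \<Longrightarrow> L x z"
  shows "\<exists>m\<in>S. \<forall>x\<in>S. x \<noteq> m \<longrightarrow> L x m"
  using assms(1,2)
proof (induction S rule: finite_ne_induct)
  case (insert s S)
  then obtain m where m: "m \<in> S" "\<forall>x\<in>S. x \<noteq> m \<longrightarrow> L x m" by blast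
  show ?case
  proof (cases "L s m")
    case True
    then show ?thesis using m by blast
  next
    case False
    then have "L m s" using assms(3) m insert by metis
    then have "\<forall>x\<in>insert s S. x \<noteq> s \<longrightarrow> L x s" using m assms(4) by (metis insert_iff)
    then show ?thesis by blast
  qed
qed simp

text \<open>Leading terms do not cancel, whatever translation invariant order defines them.\<close>

lemma keys_qt_mult_extremal:
  fixes q :: "'k::field"
  assumes "q \<noteq> 0" "a \<noteq> 0" "b \<noteq> 0"
    and total: "\<And>x y. x \<noteq> y \<Longrightarrow> L x y \<or> L y x" and trans: "\<And>x y z. L x y \<Longrightarrow> L y z \<Longrightarrow> L x z"
    and irrefl: "\<And>x. \<not> L x x" and add: "\<And>x y z. L x y \<Longrightarrow> L (x + z) (y + z)"
  obtains m n where "m \<in> Poly_Mapping.keys a" "n \<in> Poly_Mapping.keys b"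
    "m + n \<in> Poly_Mapping.keys (qt_mult q a b)" "\<And>x. x \<in> Poly_Mapping.keys a \<Longrightarrow> x \<noteq> m \<Longrightarrow> L x m"
    "\<And>x. x \<in> Poly_Mapping.keys b \<Longrightarrow> x \<noteq> n \<Longrightarrow> L x n"
proof -
  have ne: "Poly_Mapping.keys a \<noteq> {}" "Poly_Mapping.keys b \<noteq> {}" using assms by auto
  obtain m where m: "m \<in> Poly_Mapping.keys a" "\<forall>x\<in>Poly_Mapping.keys a. x \<noteq> m \<longrightarrow> L x m"
    using finite_extremal_element[OF finite_keys ne(1), of L] total trans by blast
  obtain n where n: "n \<in> Poly_Mapping.keys b" "\<forall>x\<in>Poly_Mapping.keys b. x \<noteq> n \<longrightarrow> L x n"
    using finite_extremal_element[OF finite_keys ne(2), of L] total trans by blast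
  \<comment> \<open>As \<open>x\<close> lies below \<open>m\<close>, the exponent
    \<open>m + n - x\<close> lies above \<open>n\<close>, the largest exponent of \<open>b\<close>.
    So only the pair of leading terms contributes at \<open>m + n\<close>.\<close>
  have van: "Poly_Mapping.lookup b (m + n - x) = 0" if "x \<in> Poly_Mapping.keys a" "x \<noteq> m" for x
  proof (rule ccontr)
    assume "Poly_Mapping.lookup b (m + n - x) \<noteq> 0"
    then have "m + n - x \<in> Poly_Mapping.keys b" by (simp add: in_keys_iff)
    then have *: "m + n - x = n \<or> L (m + n - x) n" using n by blast
    have "L x m" using m that by blast
    from add[OF this, of "n - x"] have "L n (m + n - x)" by (simp add: algebra_simps)
    with * show False using irrefl trans by metis
  qed
  have "Poly_Mapping.lookup (qt_mult q a b) (m + n) = (\<Sum>x\<in>Poly_Mapping.keys a.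
      if x = m then Poly_Mapping.lookup a m * Poly_Mapping.lookup b n * q powi (m $ 1 * n $ 2) else 0)"
    unfolding lookup_qt_mult[OF finite_keys subset_refl] by (rule sum.cong) (auto simp: van)
  also have "\<dots> \<noteq> 0" using m n assms by (simp add: in_keys_iff)
  finally have "m + n \<in> Poly_Mapping.keys (qt_mult q a b)" by (simp add: in_keys_iff)
  with m n show ?thesis by (intro that) auto
qed

definition lex_less :: "int^2 \<Rightarrow> int^2 \<Rightarrow> bool" where
  "lex_less x y \<longleftrightarrow> x $ 1 < y $ 1 \<or> x $ 1 = y $ 1 \<and> x $ 2 < y $ 2"

lemma lex_less:
  "x \<noteq> y \<Longrightarrow> lex_less x y \<or> lex_less y x" "lex_less x y \<Longrightarrow> lex_less y z \<Longrightarrow> lex_less x z"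
  "\<not> lex_less x x" "lex_less x y \<Longrightarrow> lex_less (x + z) (y + z)"
  by (auto simp: lex_less_def vec_eq_iff forall_2)

lemma qt_mult_0 [simp]: "qt_mult q 0 b = 0" "qt_mult q a 0 = 0"
  by (simp_all add: qt_mult_def)

text \<open>The leading term argument is used for the lexicographic order and for its reverse. The
  largest exponents of \<open>a\<close> and \<open>b\<close> add up to 0, and so do the smallest
  ones; hence largest and smallest coincide and \<open>a\<close> has a single term.\<close>

lemma qt_unit_monomial:
  fixes q :: "'k::field"
  assumes "q \<noteq> 0" "qt_mult q a b = Poly_Mapping.single 0 s" "s \<noteq> 0"
  obtains m c where "c \<noteq> 0" "a = Poly_Mapping.single m c"
proof -
  have nz: "a \<noteq> 0" "b \<noteq> 0"
    using assms by auto (metis lookup_single_eq lookup_zero)+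
  obtain m n where mn: "m \<in> Poly_Mapping.keys a" "n \<in> Poly_Mapping.keys b"
    "m + n \<in> Poly_Mapping.keys (qt_mult q a b)" "\<And>x. x \<in> Poly_Mapping.keys a \<Longrightarrow> x \<noteq> m \<Longrightarrow> lex_less x m"
    "\<And>x. x \<in> Poly_Mapping.keys b \<Longrightarrow> x \<noteq> n \<Longrightarrow> lex_less x n"
    by (rule keys_qt_mult_extremal[OF assms(1) nz, of lex_less]) (use lex_less in blast)+
  obtain m' n' where mn': "m' \<in> Poly_Mapping.keys a" "n' \<in> Poly_Mapping.keys b"
    "m' + n' \<in> Poly_Mapping.keys (qt_mult q a b)" "\<And>x. x \<in> Poly_Mapping.keys a \<Longrightarrow> x \<noteq> m' \<Longrightarrow> lex_less m' x"
    "\<And>x. x \<in> Poly_Mapping.keys b \<Longrightarrow> x \<noteq> n' \<Longrightarrow> lex_less n' x"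
    by (rule keys_qt_mult_extremal[OF assms(1) nz, of "\<lambda>x y. lex_less y x"]) (use lex_less in blast)+
  have "m + n = 0" "m' + n' = 0" using mn(3) mn'(3) assms by auto
  moreover have "m' = m \<or> lex_less m' m" "n' = n \<or> lex_less n' n" using mn mn' by blast+
  ultimately have "m' = m"
    by (auto simp: lex_less_def vec_eq_iff forall_2)
  then have "Poly_Mapping.keys a = {m}" using mn(1,4) mn'(4) lex_less(2,3) by blast
  then have "a = Poly_Mapping.single m (Poly_Mapping.lookup a m)"
    by (intro poly_mapping_eqI) (auto simp: lookup_single when_def in_keys_iff[symmetric] simp flip: not_in_keys_iff_lookup_eq_zero)
  with mn(1) show ?thesis by (intro that[of "Poly_Mapping.lookup a m" m]) (auto simp: in_keys_iff)
qed


section \<open>Automorphisms are monomial\<close>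

definition mono_map ::
    "(int^2 \<Rightarrow> 'k::field) \<Rightarrow> (int^2 \<Rightarrow> int^2) \<Rightarrow> (int^2 \<Rightarrow>\<^sub>0 'k) \<Rightarrow> (int^2 \<Rightarrow>\<^sub>0 'k)" where
  "mono_map c \<psi> a = (\<Sum>x\<in>Poly_Mapping.keys a. Poly_Mapping.single (\<psi> x) (c x * Poly_Mapping.lookup a x))"

text \<open>For additive psi, this is what comparing coefficients in phi(delta_x delta_y) =
  phi(delta_x) phi(delta_y) demands of phi = \<open>mono_map c \<psi>\<close>. If psi is the
  identity and q is nonzero, the powers of q cancel and \<open>c\<close> is a character, which gives
  the kernel of the exact sequence.\<close>

definition twisted_char :: "'k::field \<Rightarrow> (int^2 \<Rightarrow> int^2) \<Rightarrow> (int^2 \<Rightarrow> 'k) \<Rightarrow> bool" where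
  "twisted_char q \<psi> c \<longleftrightarrow> (\<forall>x. c x \<noteq> 0) \<and>
     (\<forall>x y. c (x + y) * q powi (x $ 1 * y $ 2) = c x * c y * q powi (\<psi> x $ 1 * \<psi> y $ 2))"

lemma mono_map_single: "mono_map c \<psi> (Poly_Mapping.single x s) = Poly_Mapping.single (\<psi> x) (c x * s)"
  by (cases "s = 0") (simp_all add: mono_map_def)

lemma mono_map_delta: "mono_map c \<psi> (delta x) = Poly_Mapping.single (\<psi> x) (c x)"
  by (simp add: delta_def mono_map_single)

lemma lookup_mono_map:
  assumes "inj \<psi>"
  shows "Poly_Mapping.lookup (mono_map c \<psi> a) (\<psi> x) = c x * Poly_Mapping.lookup a x"
proof -
  have "Poly_Mapping.lookup (mono_map c \<psi> a) (\<psi> x) =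
      (\<Sum>y\<in>Poly_Mapping.keys a. if y = x then c x * Poly_Mapping.lookup a x else 0)"
    unfolding mono_map_def lookup_sum using assms
    by (intro sum.cong) (auto simp: lookup_single when_def inj_eq)
  then show ?thesis by (simp add: sum.delta not_in_keys_iff_lookup_eq_zero)
qed

lemma poly_mapping_eqI_surj:
  assumes "surj \<psi>" "\<And>x. Poly_Mapping.lookup a (\<psi> x) = Poly_Mapping.lookup b (\<psi> x)"
  shows "a = b"
  using assms by (metis poly_mapping_eqI surjD)

lemma lookup_map_times [simp]:
  "Poly_Mapping.lookup (Poly_Mapping.map ((*) (s::'k::field)) a) x = s * Poly_Mapping.lookup a x"
  by (simp add: Poly_Mapping.map.rep_eq when_def)

lemma mono_map_comp:
  assumes "bij \<psi>" "bij \<psi>'"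
  shows "mono_map c \<psi> \<circ> mono_map d \<psi>' = mono_map (\<lambda>x. d x * c (\<psi>' x)) (\<psi> \<circ> \<psi>')"
proof
  fix a
  have b: "bij (\<psi> \<circ> \<psi>')" using assms by (rule bij_comp[rotated])
  have "Poly_Mapping.lookup ((mono_map c \<psi> \<circ> mono_map d \<psi>') a) ((\<psi> \<circ> \<psi>') x) =
      Poly_Mapping.lookup (mono_map (\<lambda>x. d x * c (\<psi>' x)) (\<psi> \<circ> \<psi>') a) ((\<psi> \<circ> \<psi>') x)" for x
    using assms b by (simp add: lookup_mono_map bij_is_inj del: o_apply) (simp add: lookup_mono_map bij_is_inj)
  then show "(mono_map c \<psi> \<circ> mono_map d \<psi>') a = mono_map (\<lambda>x. d x * c (\<psi>' x)) (\<psi> \<circ> \<psi>') a"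
    by (rule poly_mapping_eqI_surj[OF bij_is_surj[OF b]])
qed

lemma mono_map_id: "mono_map (\<lambda>_. 1) (\<lambda>x. x) = (\<lambda>a. a)"
proof (intro ext poly_mapping_eqI)
  fix a :: "int^2 \<Rightarrow>\<^sub>0 'k::field" and x
  show "Poly_Mapping.lookup (mono_map (\<lambda>_. 1) (\<lambda>x. x) a) x = Poly_Mapping.lookup a x"
    using lookup_mono_map[of "\<lambda>x. x" "\<lambda>_. 1" a x] by simp
qed

lemma mono_map_inject:
  assumes "mono_map c \<psi> = mono_map d \<psi>'" "\<And>x. c x \<noteq> 0"
  shows "c = d" "\<psi> = \<psi>'"
proof -
  have "Poly_Mapping.single (\<psi> x) (c x) = Poly_Mapping.single (\<psi>' x) (d x)" for x
    using fun_cong[OF assms(1), of "Poly_Mapping.single x 1"] by (simp add: mono_map_single)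
  then have "\<psi> x = \<psi>' x \<and> c x = d x" for x
    by (metis assms(2) lookup_single_eq lookup_single_not_eq)
  then show "c = d" "\<psi> = \<psi>'" by auto
qed

lemma auto_Z2_iff: "\<psi> \<in> auto Z2 \<longleftrightarrow> bij \<psi> \<and> (\<forall>x y. \<psi> (x + y) = \<psi> x + \<psi> y)"
  by (auto simp: auto_def Z2_def hom_def Bij_def)

lemma bij_mono_map:
  assumes "bij \<psi>" "\<And>x. c x \<noteq> 0"
  shows "bij (mono_map c \<psi>)"
proof (rule o_bij)
  let ?d = "\<lambda>y. inverse (c (inv_into UNIV \<psi> y))"
  have b: "bij (inv_into UNIV \<psi>)" using assms by (simp add: bij_imp_bij_inv)
  have "inv_into UNIV \<psi> \<circ> \<psi> = (\<lambda>x. x)" "\<psi> \<circ> inv_into UNIV \<psi> = (\<lambda>x. x)"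
    using assms by (auto simp: fun_eq_iff bij_is_inj bij_is_surj surj_f_inv_f)
  then show "mono_map ?d (inv_into UNIV \<psi>) \<circ> mono_map c \<psi> = id" "mono_map c \<psi> \<circ> mono_map ?d (inv_into UNIV \<psi>) = id"
    using assms b
    by (simp_all add: mono_map_comp bij_is_inj mono_map_id id_def del: o_inv_o_cancel)
qed

lemma mono_map_mult:
  assumes "bij \<psi>" and add: "\<And>x y. \<psi> (x + y) = \<psi> x + \<psi> y" and "twisted_char q \<psi> c"
  shows "mono_map c \<psi> (qt_mult q a b) = qt_mult q (mono_map c \<psi> a) (mono_map c \<psi> b)"
proof (rule poly_mapping_eqI_surj[OF bij_is_surj[OF assms(1)]])
  fix g
  have inj: "inj \<psi>" using assms by (simp add: bij_is_inj)
  have diff: "\<psi> (x - y) = \<psi> x - \<psi> y" for x y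
    using add[of "x - y" y] by (simp add: algebra_simps)
  have sub: "Poly_Mapping.keys (mono_map c \<psi> a) \<subseteq> \<psi> ` Poly_Mapping.keys a"
  proof
    fix y assume "y \<in> Poly_Mapping.keys (mono_map c \<psi> a)"
    moreover obtain x where "y = \<psi> x" using assms(1) by (metis bij_is_surj surjD)
    ultimately show "y \<in> \<psi> ` Poly_Mapping.keys a"
      by (auto simp: in_keys_iff lookup_mono_map[OF inj])
  qed
  \<comment> \<open>The twisting condition at the pair \<open>x\<close>, \<open>g - x\<close>; it
    turns the convolution at \<open>\<psi> g\<close> into the one at \<open>g\<close>, term by
    term.\<close>
  have tw: "c g * q powi (x $ 1 * (g - x) $ 2) = c x * c (g - x) * q powi (\<psi> x $ 1 * (\<psi> g - \<psi> x) $ 2)" for x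
    using assms(3) unfolding twisted_char_def by (metis add_diff_cancel_left' diff diff_add_cancel add.commute)
  have lookup_b: "Poly_Mapping.lookup (mono_map c \<psi> b) (\<psi> g - \<psi> x) = c (g - x) * Poly_Mapping.lookup b (g - x)" for x
    by (metis diff lookup_mono_map[OF inj])
  have "Poly_Mapping.lookup (qt_mult q (mono_map c \<psi> a) (mono_map c \<psi> b)) (\<psi> g) =
     (\<Sum>x\<in>Poly_Mapping.keys a. c x * Poly_Mapping.lookup a x * (c (g - x) * Poly_Mapping.lookup b (g - x))
        * q powi (\<psi> x $ 1 * (\<psi> g - \<psi> x) $ 2))"
    by (subst lookup_qt_mult[OF _ sub])
      (simp_all add: sum.reindex inj_on_subset[OF inj] lookup_mono_map[OF inj] lookup_b)
  also have "\<dots> = (\<Sum>x\<in>Poly_Mapping.keys a. Poly_Mapping.lookup a x * Poly_Mapping.lookup b (g - x)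
        * (c g * q powi (x $ 1 * (g - x) $ 2)))"
    unfolding tw by (rule sum.cong) (simp_all add: algebra_simps)
  also have "\<dots> = c g * Poly_Mapping.lookup (qt_mult q a b) g"
    by (simp add: lookup_qt_mult[OF finite_keys subset_refl] sum_distrib_left algebra_simps)
  finally show "Poly_Mapping.lookup (mono_map c \<psi> (qt_mult q a b)) (\<psi> g) =
      Poly_Mapping.lookup (qt_mult q (mono_map c \<psi> a) (mono_map c \<psi> b)) (\<psi> g)"
    by (simp add: lookup_mono_map[OF inj])
qed

lemma Aut_qt_carrier_iff:
  "\<phi> \<in> carrier (Aut_qt q) \<longleftrightarrow> bij \<phi> \<and> (\<forall>a b. \<phi> (qt_mult q a b) = qt_mult q (\<phi> a) (\<phi> b)) \<and>
     (\<forall>a b. \<phi> (a + b) = \<phi> a + \<phi> b) \<and> \<phi> (delta 0) = delta 0 \<and>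
     (\<forall>s a. \<phi> (Poly_Mapping.map ((*) s) a) = Poly_Mapping.map ((*) s) (\<phi> a))"
  by (auto simp: Aut_qt_def quantum_torus_def ring_hom_def Bij_def)

lemma mono_map_in_Aut_qt:
  fixes q :: "'k::field"
  assumes "q \<noteq> 0" "\<psi> \<in> auto Z2" "twisted_char q \<psi> c"
  shows "mono_map c \<psi> \<in> carrier (Aut_qt q)"
proof -
  have \<psi>: "bij \<psi>" "\<And>x y. \<psi> (x + y) = \<psi> x + \<psi> y" using assms by (auto simp: auto_Z2_iff)
  note inj = bij_is_inj[OF \<psi>(1)] and ext = poly_mapping_eqI_surj[OF bij_is_surj[OF \<psi>(1)]]
  have c: "c x \<noteq> 0" for x using assms by (simp add: twisted_char_def)
  have "\<psi> 0 = 0" using \<psi>(2)[of 0 0] by simp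
  moreover have "c 0 = 1"
  proof -
    have "c 0 = c 0 * c 0" using assms(3) \<open>\<psi> 0 = 0\<close> unfolding twisted_char_def
      by (metis (no_types) add_0 mult_1_right mult_zero_left power_int_0_right zero_index)
    then show ?thesis using c[of 0] by simp
  qed
  ultimately have "mono_map c \<psi> (delta 0) = delta 0" by (simp add: mono_map_delta) (simp add: delta_def)
  moreover have "mono_map c \<psi> (a + b) = mono_map c \<psi> a + mono_map c \<psi> b" for a b
    by (rule ext) (simp add: lookup_mono_map[OF inj] lookup_add algebra_simps)
  moreover have "mono_map c \<psi> (Poly_Mapping.map ((*) s) a) = Poly_Mapping.map ((*) s) (mono_map c \<psi> a)" for s a
    by (rule ext) (simp add: lookup_mono_map[OF inj])
  ultimately show ?thesis
    using mono_map_mult[OF \<psi> assms(3)] bij_mono_map[OF \<psi>(1) c] by (simp add: Aut_qt_carrier_iff)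
qed

lemma poly_mapping_sum_single:
  "(a :: 'a \<Rightarrow>\<^sub>0 'b::comm_monoid_add) =
     (\<Sum>x\<in>Poly_Mapping.keys a. Poly_Mapping.single x (Poly_Mapping.lookup a x))"
  by (intro poly_mapping_eqI)
    (simp add: lookup_sum lookup_single when_def sum.delta not_in_keys_iff_lookup_eq_zero)

lemma Aut_qt_mono_map:
  fixes q :: "'k::field"
  assumes "q \<noteq> 0" "\<phi> \<in> carrier (Aut_qt q)"
  obtains c \<psi> where "\<psi> \<in> auto Z2" "twisted_char q \<psi> c" "\<phi> = mono_map c \<psi>"
proof -
  note \<phi> = assms(2)[unfolded Aut_qt_carrier_iff]
  have smult: "\<phi> (Poly_Mapping.single x (s * t)) = Poly_Mapping.map ((*) s) (\<phi> (Poly_Mapping.single x t))" for x s t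
    using \<phi> by (metis map_single mult_zero_right)
  have mult_single: "qt_mult q (Poly_Mapping.single x s) (Poly_Mapping.single y t) =
      Poly_Mapping.single (x + y) (s * t * q powi (x $ 1 * y $ 2))" for x y :: "int^2" and s t
    by (cases "s = 0"; cases "t = 0") (simp_all add: qt_mult_def)
  have zero: "\<phi> 0 = 0" using \<phi> by (metis add_cancel_right_right)
  \<comment> \<open>The product of \<open>delta x\<close> and \<open>delta (- x)\<close> is a
    nonzero scalar. The automorphism fixes scalars, so the image of \<open>delta x\<close> is a
    factor of a nonzero scalar and hence a monomial.\<close>
  have "\<exists>m c. c \<noteq> 0 \<and> \<phi> (delta x) = Poly_Mapping.single m c" for x
  proof -
    let ?s = "q powi (x $ 1 * (- x) $ 2)"
    have "qt_mult q (\<phi> (delta x)) (\<phi> (delta (- x))) = \<phi> (qt_mult q (delta x) (delta (- x)))" using \<phi> by simp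
    also have "qt_mult q (delta x) (delta (- x)) = Poly_Mapping.single 0 (?s * 1)"
      by (simp add: delta_def mult_single)
    also have "\<phi> (Poly_Mapping.single 0 (?s * 1)) = Poly_Mapping.map ((*) ?s) (\<phi> (delta 0))"
      by (simp only: smult delta_def)
    also have "\<dots> = Poly_Mapping.single 0 ?s" using \<phi> by (simp add: delta_def del: single_one)
    finally show ?thesis using qt_unit_monomial[OF assms(1)] assms(1) by (metis power_int_not_zero)
  qed
  then obtain \<psi> c where c: "\<And>x. c x \<noteq> 0" and \<psi>: "\<And>x. \<phi> (delta x) = Poly_Mapping.single (\<psi> x) (c x)"
    by metis
  have single: "\<phi> (Poly_Mapping.single x s) = Poly_Mapping.single (\<psi> x) (c x * s)" for x s
    using smult[of x s 1] \<psi>[of x] by (simp add: delta_def mult.commute)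
  have \<phi>_sum: "\<phi> (sum f X) = (\<Sum>x\<in>X. \<phi> (f x))" if "finite X" for f :: "int^2 \<Rightarrow> _" and X
    using that by induction (use zero \<phi> in auto)
  have eq: "\<phi> = mono_map c \<psi>"
  proof
    fix a show "\<phi> a = mono_map c \<psi> a"
      by (subst poly_mapping_sum_single[of a]) (simp add: \<phi>_sum single mono_map_def)
  qed
  have *: "\<psi> (x + y) = \<psi> x + \<psi> y \<and>
      c (x + y) * q powi (x $ 1 * y $ 2) = c x * c y * q powi (\<psi> x $ 1 * \<psi> y $ 2)" for x y
  proof -
    have "\<phi> (qt_mult q (delta x) (delta y)) = qt_mult q (\<phi> (delta x)) (\<phi> (delta y))" using \<phi> by blast
    then have "Poly_Mapping.single (\<psi> (x + y)) (c (x + y) * q powi (x $ 1 * y $ 2)) =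
       Poly_Mapping.single (\<psi> x + \<psi> y) (c x * c y * q powi (\<psi> x $ 1 * \<psi> y $ 2))"
      by (simp add: single mult_single delta_def)
    moreover have "c (x + y) * q powi (x $ 1 * y $ 2) \<noteq> 0" using c assms by simp
    ultimately show ?thesis by (metis lookup_single_eq lookup_single_not_eq)
  qed
  have "inj \<psi>"
  proof
    fix x y assume "\<psi> x = \<psi> y"
    then have "\<phi> (Poly_Mapping.single x (1 / c x)) = \<phi> (Poly_Mapping.single y (1 / c y))"
      using c by (simp add: single)
    then have "Poly_Mapping.single x (1 / c x) = Poly_Mapping.single y (1 / c y)"
      using \<phi> by (meson bij_is_inj injD)
    then show "x = y" using c by (metis divide_eq_0_iff lookup_single_eq lookup_single_not_eq zero_neq_one)
  qed
  \<comment> \<open>Compare supports: a preimage of \<open>delta y\<close> must have a term whose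
    exponent psi moves to \<open>y\<close>.\<close>
  moreover have "surj \<psi>"
  proof (rule surjI)
    fix y
    obtain a where "mono_map c \<psi> a = delta y" using \<phi> eq by (metis bij_is_surj surjD)
    then have "Poly_Mapping.lookup (mono_map c \<psi> a) y \<noteq> 0" by (simp add: delta_def)
    then have "\<exists>x\<in>Poly_Mapping.keys a. Poly_Mapping.lookup (Poly_Mapping.single (\<psi> x) (c x * Poly_Mapping.lookup a x)) y \<noteq> 0"
      unfolding mono_map_def lookup_sum by (meson sum.neutral)
    then have "\<exists>x. \<psi> x = y" by (metis lookup_single_not_eq)
    then show "\<psi> (SOME x. \<psi> x = y) = y" by (rule someI_ex)
  qed
  ultimately have "\<psi> \<in> auto Z2" using * by (simp add: auto_Z2_iff bij_def)
  moreover have "twisted_char q \<psi> c" using * c by (simp add: twisted_char_def)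
  ultimately show ?thesis using that eq by blast
qed

lemma lattice_part_mono_map:
  fixes c :: "int^2 \<Rightarrow> 'k::field"
  assumes "\<psi> \<in> auto Z2" "\<And>x. c x \<noteq> 0"
  shows "lattice_part (mono_map c \<psi>) = \<psi>"
proof -
  have img: "mono_map c \<psi> ` range (Poly_Mapping.single x) = range (Poly_Mapping.single (\<psi> x))" for x
  proof -
    have "range (\<lambda>s. Poly_Mapping.single (\<psi> x) (c x * s)) = Poly_Mapping.single (\<psi> x) ` range ((*) (c x))"
      by (simp add: image_image)
    also have "range ((*) (c x)) = UNIV"
      using assms(2)[of x] by (intro surjI[of _ "\<lambda>s. s / c x"]) simp
    finally show ?thesis by (simp add: image_image mono_map_single)
  qed
  \<comment> \<open>Different exponents span different lines; this makes the definite description in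
    \<open>lattice_part\<close> unique.\<close>
  have "x = y" if "range (Poly_Mapping.single x :: 'k \<Rightarrow> _) = range (Poly_Mapping.single y)" for x y :: "int^2"
  proof -
    have "Poly_Mapping.single x (1::'k) \<in> range (Poly_Mapping.single y)" using that by blast
    then show ?thesis by (metis lookup_single_eq lookup_single_not_eq zero_neq_one rangeE)
  qed
  then show ?thesis
    unfolding lattice_part_def using assms(1) img by (intro the_equality) (auto simp: fun_eq_iff)
qed


section \<open>The exact sequence\<close>

lemma bij_ident [simp]: "bij (\<lambda>x. x)"
  using bij_id by (simp add: id_def)

lemma mem_char_group:
  "\<theta> \<in> carrier char_group \<longleftrightarrow> (\<forall>x. \<theta> x \<noteq> 0) \<and> (\<forall>x y. \<theta> (x + y) = \<theta> x * \<theta> y)"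
  by (auto simp: char_group_def hom_def Z2_def unit_group_def)

lemma comm_group_char_group: "comm_group (char_group :: (int^2 \<Rightarrow> 'k::field) monoid)"
proof (rule comm_groupI)
  fix \<theta> :: "int^2 \<Rightarrow> 'k" assume "\<theta> \<in> carrier char_group"
  then have "(\<lambda>x. inverse (\<theta> x)) \<in> carrier char_group" "\<And>x. inverse (\<theta> x) * \<theta> x = 1"
    by (simp_all add: mem_char_group)
  then show "\<exists>\<theta>'\<in>carrier char_group. \<theta>' \<otimes>\<^bsub>char_group\<^esub> \<theta> = \<one>\<^bsub>char_group\<^esub>"
    by (intro bexI[of _ "\<lambda>x. inverse (\<theta> x)"]) (simp_all add: char_group_def)
qed (simp_all add: mem_char_group, simp_all add: char_group_def fun_eq_iff)

lemma Aut_qt_simps: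
  "\<phi> \<in> carrier (Aut_qt q) \<Longrightarrow> \<phi>' \<in> carrier (Aut_qt q) \<Longrightarrow> \<phi> \<otimes>\<^bsub>Aut_qt q\<^esub> \<phi>' = \<phi> \<circ> \<phi>'"
  "\<one>\<^bsub>Aut_qt q\<^esub> = (\<lambda>a. a)"
  by (auto simp: Aut_qt_def BijGroup_def quantum_torus_def compose_def fun_eq_iff)

lemma group_Aut_qt: "group (Aut_qt q)"
proof (rule groupI)
  fix \<phi> \<phi>' assume "\<phi> \<in> carrier (Aut_qt q)" "\<phi>' \<in> carrier (Aut_qt q)"
  then show "\<phi> \<otimes>\<^bsub>Aut_qt q\<^esub> \<phi>' \<in> carrier (Aut_qt q)"
    by (simp add: Aut_qt_simps) (simp add: Aut_qt_carrier_iff bij_comp)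
next
  show one: "\<one>\<^bsub>Aut_qt q\<^esub> \<in> carrier (Aut_qt q)"
    by (simp add: Aut_qt_simps Aut_qt_carrier_iff)
  fix \<phi> assume \<phi>: "\<phi> \<in> carrier (Aut_qt q)"
  then show "\<one>\<^bsub>Aut_qt q\<^esub> \<otimes>\<^bsub>Aut_qt q\<^esub> \<phi> = \<phi>"
    using one by (simp add: Aut_qt_simps) (simp add: Aut_qt_simps fun_eq_iff)
  define \<phi>' where "\<phi>' = inv_into UNIV \<phi>"
  have b: "bij \<phi>" using \<phi> by (simp add: Aut_qt_carrier_iff)
  have i: "\<phi> (\<phi>' a) = a" "\<phi>' (\<phi> a) = a" for a
    using b by (simp_all add: \<phi>'_def bij_is_inj bij_is_surj surj_f_inv_f)
  have "bij \<phi>'" using b by (simp add: \<phi>'_def bij_imp_bij_inv)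
  moreover have "\<phi>' (qt_mult q a b) = qt_mult q (\<phi>' a) (\<phi>' b)" "\<phi>' (a + b) = \<phi>' a + \<phi>' b"
    "\<phi>' (delta 0) = delta 0" "\<phi>' (Poly_Mapping.map ((*) s) a) = Poly_Mapping.map ((*) s) (\<phi>' a)" for a b s
    using \<phi> unfolding Aut_qt_carrier_iff by (metis i)+
  ultimately have \<phi>': "\<phi>' \<in> carrier (Aut_qt q)" by (simp add: Aut_qt_carrier_iff)
  then show "\<exists>\<phi>'\<in>carrier (Aut_qt q). \<phi>' \<otimes>\<^bsub>Aut_qt q\<^esub> \<phi> = \<one>\<^bsub>Aut_qt q\<^esub>"
    using \<phi> by (intro bexI[of _ \<phi>']) (auto simp: Aut_qt_simps i fun_eq_iff)
next
  fix a b c assume "a \<in> carrier (Aut_qt q)" "b \<in> carrier (Aut_qt q)" "c \<in> carrier (Aut_qt q)"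
  moreover from this have "a \<circ> b \<in> carrier (Aut_qt q)" "b \<circ> c \<in> carrier (Aut_qt q)"
    by (auto simp: Aut_qt_carrier_iff bij_comp)
  ultimately show "a \<otimes>\<^bsub>Aut_qt q\<^esub> b \<otimes>\<^bsub>Aut_qt q\<^esub> c = a \<otimes>\<^bsub>Aut_qt q\<^esub> (b \<otimes>\<^bsub>Aut_qt q\<^esub> c)"
    by (simp add: Aut_qt_simps comp_assoc)
qed

lemma Aut_lam_carrier_iff:
  "\<psi> \<in> carrier (Aut_lam q) \<longleftrightarrow> \<psi> \<in> auto Z2 \<and> (\<forall>x y. lam q (\<psi> x) (\<psi> y) = lam q x y)"
  by (simp add: Aut_lam_def)

lemma Aut_lam_simps:
  "\<psi> \<in> carrier (Aut_lam q) \<Longrightarrow> \<psi>' \<in> carrier (Aut_lam q) \<Longrightarrow> \<psi> \<otimes>\<^bsub>Aut_lam q\<^esub> \<psi>' = \<psi> \<circ> \<psi>'"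
  "\<one>\<^bsub>Aut_lam q\<^esub> = (\<lambda>x. x)"
  by (auto simp: Aut_lam_def AutoGroup_def auto_def BijGroup_def Z2_def compose_def fun_eq_iff)

lemma group_Aut_lam: "group (Aut_lam q)"
proof (rule groupI)
  fix \<psi> \<psi>' assume "\<psi> \<in> carrier (Aut_lam q)" "\<psi>' \<in> carrier (Aut_lam q)"
  then show "\<psi> \<otimes>\<^bsub>Aut_lam q\<^esub> \<psi>' \<in> carrier (Aut_lam q)"
    by (simp add: Aut_lam_simps) (simp add: Aut_lam_carrier_iff auto_Z2_iff bij_comp)
next
  show one: "\<one>\<^bsub>Aut_lam q\<^esub> \<in> carrier (Aut_lam q)"
    by (simp add: Aut_lam_simps Aut_lam_carrier_iff auto_Z2_iff)
  fix \<psi> assume \<psi>: "\<psi> \<in> carrier (Aut_lam q)"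
  then show "\<one>\<^bsub>Aut_lam q\<^esub> \<otimes>\<^bsub>Aut_lam q\<^esub> \<psi> = \<psi>"
    using one by (simp add: Aut_lam_simps) (simp add: Aut_lam_simps fun_eq_iff)
  define \<psi>' where "\<psi>' = inv_into UNIV \<psi>"
  have b: "bij \<psi>" using \<psi> by (simp add: Aut_lam_carrier_iff auto_Z2_iff)
  have i: "\<psi> (\<psi>' a) = a" "\<psi>' (\<psi> a) = a" for a
    using b by (simp_all add: \<psi>'_def bij_is_inj bij_is_surj surj_f_inv_f)
  have "bij \<psi>'" using b by (simp add: \<psi>'_def bij_imp_bij_inv)
  moreover have "\<psi>' (x + y) = \<psi>' x + \<psi>' y" for x y
    using \<psi> unfolding Aut_lam_carrier_iff auto_Z2_iff by (metis i)
  moreover have "lam q (\<psi>' x) (\<psi>' y) = lam q x y" for x y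
    using \<psi> unfolding Aut_lam_carrier_iff by (metis i)
  ultimately have "\<psi>' \<in> carrier (Aut_lam q)"
    by (simp add: Aut_lam_carrier_iff auto_Z2_iff)
  then show "\<exists>\<psi>'\<in>carrier (Aut_lam q). \<psi>' \<otimes>\<^bsub>Aut_lam q\<^esub> \<psi> = \<one>\<^bsub>Aut_lam q\<^esub>"
    using \<psi> by (intro bexI[of _ \<psi>']) (auto simp: Aut_lam_simps i fun_eq_iff)
next
  fix a b c assume "a \<in> carrier (Aut_lam q)" "b \<in> carrier (Aut_lam q)" "c \<in> carrier (Aut_lam q)"
  moreover from this have "a \<circ> b \<in> carrier (Aut_lam q)" "b \<circ> c \<in> carrier (Aut_lam q)"
    by (auto simp: Aut_lam_carrier_iff auto_Z2_iff bij_comp)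
  ultimately show "a \<otimes>\<^bsub>Aut_lam q\<^esub> b \<otimes>\<^bsub>Aut_lam q\<^esub> c = a \<otimes>\<^bsub>Aut_lam q\<^esub> (b \<otimes>\<^bsub>Aut_lam q\<^esub> c)"
    by (simp add: Aut_lam_simps comp_assoc)
qed

lemma char_aut_eq_mono_map: "char_aut \<theta> = mono_map \<theta> (\<lambda>x. x)"
proof (intro ext poly_mapping_eqI)
  fix a x
  show "Poly_Mapping.lookup (char_aut \<theta> a) x = Poly_Mapping.lookup (mono_map \<theta> (\<lambda>x. x) a) x"
    using lookup_mono_map[of "\<lambda>x. x" \<theta> a x]
    by (simp add: char_aut_def lookup_mapp when_def in_keys_iff)
qed

lemma id_auto_Z2: "(\<lambda>x. x) \<in> auto Z2"
  by (simp add: auto_Z2_iff)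

lemma char_aut_in_Aut_qt:
  assumes "q \<noteq> 0" "\<theta> \<in> carrier char_group"
  shows "char_aut \<theta> \<in> carrier (Aut_qt q)"
  unfolding char_aut_eq_mono_map using assms
  by (intro mono_map_in_Aut_qt id_auto_Z2) (simp_all add: twisted_char_def mem_char_group)

lemma char_aut_mult: "char_aut (\<lambda>x. \<theta> x * \<theta>' x) = char_aut \<theta> \<circ> char_aut \<theta>'"
  by (simp add: char_aut_eq_mono_map mono_map_comp) (simp add: comp_def mult.commute)

lemma char_aut_inject:
  assumes "char_aut \<theta> = char_aut \<theta>'" "\<theta> \<in> carrier char_group"
  shows "\<theta> = \<theta>'"
  using assms(2)
  by (intro mono_map_inject(1)[OF assms(1)[unfolded char_aut_eq_mono_map]]) (simp add: mem_char_group)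

lemma lattice_part_Aut_qt:
  assumes "q \<noteq> 0" "\<phi> \<in> carrier (Aut_qt q)"
  obtains c where "\<phi> = mono_map c (lattice_part \<phi>)" "lattice_part \<phi> \<in> auto Z2"
    "twisted_char q (lattice_part \<phi>) c"
proof -
  obtain c \<psi> where c: "\<psi> \<in> auto Z2" "twisted_char q \<psi> c" "\<phi> = mono_map c \<psi>"
    by (rule Aut_qt_mono_map[OF assms])
  then have "lattice_part \<phi> = \<psi>" by (simp add: lattice_part_mono_map twisted_char_def)
  with c show ?thesis using that by simp
qed

text \<open>\<open>lam q x y\<close> is the factor by which delta_x and delta_y fail to commute.
  Dividing the twisting condition at (x, y) by the one at (y, x) removes the values of
  \<open>c\<close>, which enter symmetrically.\<close>

lemma lattice_part_in_Aut_lam: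
  assumes "q \<noteq> 0" "\<phi> \<in> carrier (Aut_qt q)"
  shows "lattice_part \<phi> \<in> carrier (Aut_lam q)"
proof -
  define \<psi> where "\<psi> = lattice_part \<phi>"
  obtain c where c: "\<psi> \<in> auto Z2" "twisted_char q \<psi> c"
    using lattice_part_Aut_qt[OF assms] unfolding \<psi>_def by metis
  have nz: "c x \<noteq> 0" for x using c by (simp add: twisted_char_def)
  have tw: "c (x + y) * q powi (x $ 1 * y $ 2) = c x * c y * q powi (\<psi> x $ 1 * \<psi> y $ 2)" for x y
    using c by (simp add: twisted_char_def)
  have "lam q (\<psi> x) (\<psi> y) = lam q x y" for x y
  proof -
    have "lam q (\<psi> x) (\<psi> y) = (c x * c y * q powi (\<psi> x $ 1 * \<psi> y $ 2)) / (c y * c x * q powi (\<psi> y $ 1 * \<psi> x $ 2))"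
      using assms(1) nz by (simp add: lam_def power_int_diff mult.commute)
    also have "\<dots> = (c (x + y) * q powi (x $ 1 * y $ 2)) / (c (x + y) * q powi (y $ 1 * x $ 2))"
      using tw[of x y] tw[of y x] by (simp add: add.commute)
    also have "\<dots> = lam q x y"
      using assms(1) nz by (simp add: lam_def power_int_diff mult.commute)
    finally show ?thesis .
  qed
  then show ?thesis using c by (simp add: Aut_lam_carrier_iff flip: \<psi>_def)
qed

lemma lattice_part_comp:
  assumes "q \<noteq> 0" "\<phi> \<in> carrier (Aut_qt q)" "\<phi>' \<in> carrier (Aut_qt q)"
  shows "lattice_part (\<phi> \<circ> \<phi>') = lattice_part \<phi> \<circ> lattice_part \<phi>'"
proof -
  obtain c where c: "\<phi> = mono_map c (lattice_part \<phi>)" "lattice_part \<phi> \<in> auto Z2" "\<And>x. c x \<noteq> 0"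
    using lattice_part_Aut_qt[OF assms(1,2)] by (metis twisted_char_def)
  obtain d where d: "\<phi>' = mono_map d (lattice_part \<phi>')" "lattice_part \<phi>' \<in> auto Z2" "\<And>x. d x \<noteq> 0"
    using lattice_part_Aut_qt[OF assms(1,3)] by (metis twisted_char_def)
  have b: "bij (lattice_part \<phi>)" "bij (lattice_part \<phi>')" using c d by (simp_all add: auto_Z2_iff)
  have "\<phi> \<circ> \<phi>' = mono_map (\<lambda>x. d x * c (lattice_part \<phi>' x)) (lattice_part \<phi> \<circ> lattice_part \<phi>')"
    using mono_map_comp[OF b, of c d] c d by simp
  moreover have "lattice_part \<phi> \<circ> lattice_part \<phi>' \<in> auto Z2"
    using c d by (simp add: auto_Z2_iff bij_comp)
  ultimately show ?thesis using c d by (simp add: lattice_part_mono_map)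
qed

lemma lattice_part_hom:
  assumes "q \<noteq> 0"
  shows "lattice_part \<in> hom (Aut_qt q) (Aut_lam q)"
  using assms by (auto intro!: homI simp: lattice_part_in_Aut_lam Aut_qt_simps Aut_lam_simps lattice_part_comp)

lemma lattice_part_char_aut:
  assumes "\<theta> \<in> carrier char_group"
  shows "lattice_part (char_aut \<theta>) = (\<lambda>x. x)"
  using assms by (simp add: char_aut_eq_mono_map lattice_part_mono_map id_auto_Z2 mem_char_group)

lemma char_aut_image:
  assumes "q \<noteq> 0"
  shows "char_aut ` carrier char_group = kernel (Aut_qt q) (Aut_lam q) lattice_part"
proof
  show "char_aut ` carrier char_group \<subseteq> kernel (Aut_qt q) (Aut_lam q) lattice_part"
    using assms by (auto simp: kernel_def char_aut_in_Aut_qt lattice_part_char_aut Aut_lam_simps)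
  show "kernel (Aut_qt q) (Aut_lam q) lattice_part \<subseteq> char_aut ` carrier char_group"
  proof
    fix \<phi> assume "\<phi> \<in> kernel (Aut_qt q) (Aut_lam q) lattice_part"
    then have \<phi>: "\<phi> \<in> carrier (Aut_qt q)" "lattice_part \<phi> = (\<lambda>x. x)"
      by (auto simp: kernel_def Aut_lam_simps)
    obtain c where c: "\<phi> = char_aut c" "twisted_char q (\<lambda>x. x) c"
      using lattice_part_Aut_qt[OF assms \<phi>(1)] \<phi>(2) by (metis char_aut_eq_mono_map)
    then have "c \<in> carrier char_group" using assms by (simp add: twisted_char_def mem_char_group)
    with c show "\<phi> \<in> char_aut ` carrier char_group" by blast
  qed
qed

lemma char_aut_mon:
  assumes "q \<noteq> 0"
  shows "char_aut \<in> mon char_group (Aut_qt q)"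
proof -
  have "char_aut (\<theta> \<otimes>\<^bsub>char_group\<^esub> \<theta>') = char_aut \<theta> \<circ> char_aut \<theta>'" for \<theta> \<theta>' :: "int^2 \<Rightarrow> 'a"
    by (simp add: char_group_def char_aut_mult)
  then show ?thesis
    using assms by (auto simp: mon_def inj_on_def char_aut_inject char_aut_in_Aut_qt Aut_qt_simps intro!: homI)
qed


section \<open>Splittings and cocycles\<close>

text \<open>The action by conjugation, written as an exchange rule so that no inverse in the
  automorphism group occurs. It explains the composition with an inverse in
  \<open>char_act\<close>.\<close>

lemma conj_char_aut:
  assumes "q \<noteq> 0" "\<phi> \<in> carrier (Aut_qt q)" "\<And>x. \<psi>' (lattice_part \<phi> x) = x"
  shows "char_aut (\<theta> \<circ> \<psi>') \<circ> \<phi> = \<phi> \<circ> char_aut \<theta>"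
proof -
  obtain c where c: "\<phi> = mono_map c (lattice_part \<phi>)" "lattice_part \<phi> \<in> auto Z2"
    using lattice_part_Aut_qt[OF assms(1,2)] by metis
  have b: "bij (lattice_part \<phi>)" "bij (\<lambda>x::int^2. x)" using c by (simp_all add: auto_Z2_iff)
  have "char_aut (\<theta> \<circ> \<psi>') \<circ> mono_map c (lattice_part \<phi>) = mono_map c (lattice_part \<phi>) \<circ> char_aut \<theta>"
    unfolding char_aut_eq_mono_map mono_map_comp[OF b] mono_map_comp[OF b(2,1)]
    by (simp add: assms(3) comp_def mult.commute)
  then show ?thesis using c(1) by simp
qed

lemma mem_char_Z1:
  "f \<in> carrier (char_Z1 G \<rho>) \<longleftrightarrow> f \<in> carrier G \<rightarrow>\<^sub>E carrier char_group \<and>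
     (\<forall>g\<in>carrier G. \<forall>h\<in>carrier G. f (g \<otimes>\<^bsub>G\<^esub> h) = (\<lambda>x. f g x * f h (\<rho> (inv\<^bsub>G\<^esub> g) x)))"
  by (simp add: char_Z1_def Z1_def char_act_def char_group_def comp_def)

text \<open>Splittings form a torsor under the cocycles. By the exchange rule, multiplicativity of
  the twisted map is the cocycle identity; conversely two splittings differ at each \<open>g\<close>
  by an automorphism with trivial lattice part, which exactness makes a character. A general
  \<open>\<rho>\<close> allows the result to be applied to the matrix groups themselves.\<close>

lemma twist_bij:
  assumes q: "q \<noteq> 0" and G: "group G" and \<rho>: "\<rho> \<in> hom G (Aut_lam q)" and \<sigma>\<^sub>0: "\<sigma>\<^sub>0 \<in> splittings q G \<rho>"
  shows "bij_betw (\<lambda>f. twist q G f \<sigma>\<^sub>0) (carrier (char_Z1 G \<rho>)) (splittings q G \<rho>)"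
proof -
  interpret G: group G by (fact G)
  interpret Aut: group "Aut_qt q" by (rule group_Aut_qt)
  have \<sigma>_in: "\<sigma> g \<in> carrier (Aut_qt q)" and \<sigma>_lat: "lattice_part (\<sigma> g) = \<rho> g"
    if "\<sigma> \<in> splittings q G \<rho>" "g \<in> carrier G" for \<sigma> g
    using that by (auto simp: splittings_def hom_def)
  have \<sigma>_mult: "\<sigma> (g \<otimes>\<^bsub>G\<^esub> h) = \<sigma> g \<circ> \<sigma> h"
    if "\<sigma> \<in> splittings q G \<rho>" "g \<in> carrier G" "h \<in> carrier G" for \<sigma> g h
  proof -
    have "\<sigma> (g \<otimes>\<^bsub>G\<^esub> h) = \<sigma> g \<otimes>\<^bsub>Aut_qt q\<^esub> \<sigma> h" using that by (simp add: splittings_def hom_def)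
    then show ?thesis using that by (simp add: Aut_qt_simps \<sigma>_in)
  qed
  have \<rho>_inv: "\<rho> (inv\<^bsub>G\<^esub> g) (\<rho> g x) = x" if "g \<in> carrier G" for g x
  proof -
    have "\<rho> (inv\<^bsub>G\<^esub> g) \<otimes>\<^bsub>Aut_lam q\<^esub> \<rho> g = \<rho> (inv\<^bsub>G\<^esub> g \<otimes>\<^bsub>G\<^esub> g)"
      by (subst hom_mult[OF \<rho>]) (simp_all add: that)
    also have "\<dots> = \<one>\<^bsub>Aut_lam q\<^esub>" using that hom_one[OF \<rho> G group_Aut_lam] by simp
    finally show ?thesis using \<rho> that by (simp add: Aut_lam_simps hom_in_carrier fun_eq_iff)
  qed
  have conj: "\<sigma>\<^sub>0 g \<circ> char_aut \<theta> = char_aut (\<theta> \<circ> \<rho> (inv\<^bsub>G\<^esub> g)) \<circ> \<sigma>\<^sub>0 g" if "g \<in> carrier G" for g \<theta>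
    using conj_char_aut[OF q \<sigma>_in[OF \<sigma>\<^sub>0 that], of "\<rho> (inv\<^bsub>G\<^esub> g)"] \<rho>_inv[OF that] \<sigma>_lat[OF \<sigma>\<^sub>0 that] by simp
  have cancel: "\<theta> = \<theta>'" if "char_aut \<theta> \<circ> \<sigma>\<^sub>0 g = char_aut \<theta>' \<circ> \<sigma>\<^sub>0 g" "g \<in> carrier G" "\<theta> \<in> carrier char_group" for \<theta> \<theta>' g
  proof -
    have "surj (\<sigma>\<^sub>0 g)" using \<sigma>_in[OF \<sigma>\<^sub>0 that(2)] by (simp add: Aut_qt_carrier_iff bij_is_surj)
    then have "char_aut \<theta> = char_aut \<theta>'" using that(1) by (metis comp_apply ext surjD)
    then show ?thesis using that(3) by (rule char_aut_inject)
  qed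
  have twist: "twist q G f \<sigma>\<^sub>0 g = char_aut (f g) \<circ> \<sigma>\<^sub>0 g"
    if "f \<in> carrier G \<rightarrow> carrier char_group" "g \<in> carrier G" for f g
    using that Aut_qt_simps(1)[OF char_aut_in_Aut_qt[OF q funcset_mem[OF that]] \<sigma>_in[OF \<sigma>\<^sub>0 that(2)]]
    by (simp add: twist_def)
  \<comment> \<open>The inner character is moved to the left past \<open>\<sigma>\<^sub>0 g\<close>.
    Comparison with the value at the product yields the cocycle identity, and both inclusions below
    rely on it.\<close>
  have comp: "(char_aut \<theta> \<circ> \<sigma>\<^sub>0 g) \<circ> (char_aut \<theta>' \<circ> \<sigma>\<^sub>0 h) =
      char_aut (\<lambda>x. \<theta> x * \<theta>' (\<rho> (inv\<^bsub>G\<^esub> g) x)) \<circ> \<sigma>\<^sub>0 (g \<otimes>\<^bsub>G\<^esub> h)"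
    if "g \<in> carrier G" "h \<in> carrier G" for g h \<theta> \<theta>'
  proof -
    have "(char_aut \<theta> \<circ> \<sigma>\<^sub>0 g) \<circ> (char_aut \<theta>' \<circ> \<sigma>\<^sub>0 h) = char_aut \<theta> \<circ> (\<sigma>\<^sub>0 g \<circ> char_aut \<theta>') \<circ> \<sigma>\<^sub>0 h"
      by (simp only: comp_assoc)
    also have "\<dots> = (char_aut \<theta> \<circ> char_aut (\<theta>' \<circ> \<rho> (inv\<^bsub>G\<^esub> g))) \<circ> (\<sigma>\<^sub>0 g \<circ> \<sigma>\<^sub>0 h)"
      unfolding conj[OF that(1)] by (simp only: comp_assoc)
    finally show ?thesis using that by (simp add: char_aut_mult \<sigma>_mult[OF \<sigma>\<^sub>0] comp_def[of \<theta>'])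
  qed
  show ?thesis
  proof (rule bij_betw_imageI)
    show "inj_on (\<lambda>f. twist q G f \<sigma>\<^sub>0) (carrier (char_Z1 G \<rho>))"
    proof (rule inj_onI)
      fix f f' assume f: "f \<in> carrier (char_Z1 G \<rho>)" "f' \<in> carrier (char_Z1 G \<rho>)"
        and eq: "twist q G f \<sigma>\<^sub>0 = twist q G f' \<sigma>\<^sub>0"
      then have PiE: "f \<in> carrier G \<rightarrow>\<^sub>E carrier char_group" "f' \<in> carrier G \<rightarrow>\<^sub>E carrier char_group"
        by (simp_all add: mem_char_Z1)
      then have Pi: "f \<in> carrier G \<rightarrow> carrier char_group" "f' \<in> carrier G \<rightarrow> carrier char_group"
        by (simp_all add: PiE_def)
      have "f g = f' g" if "g \<in> carrier G" for g
        using twist[OF Pi(1) that] twist[OF Pi(2) that] fun_cong[OF eq, of g]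
        by (intro cancel[OF _ that funcset_mem[OF Pi(1) that]]) simp
      then show "f = f'" by (rule PiE_ext[OF PiE])
    qed
    show "(\<lambda>f. twist q G f \<sigma>\<^sub>0) ` carrier (char_Z1 G \<rho>) = splittings q G \<rho>"
    proof (intro equalityI subsetI)
      fix \<sigma> assume "\<sigma> \<in> (\<lambda>f. twist q G f \<sigma>\<^sub>0) ` carrier (char_Z1 G \<rho>)"
      then obtain f where f: "f \<in> carrier (char_Z1 G \<rho>)" "\<sigma> = twist q G f \<sigma>\<^sub>0" by blast
      then have Pi: "f \<in> carrier G \<rightarrow> carrier char_group" by (auto simp: mem_char_Z1)
      have \<sigma>: "\<sigma> g = char_aut (f g) \<circ> \<sigma>\<^sub>0 g" if "g \<in> carrier G" for g
        using twist[OF Pi that] f by simp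
      have char_in: "char_aut (f g) \<in> carrier (Aut_qt q)" if "g \<in> carrier G" for g
        using Pi that q by (intro char_aut_in_Aut_qt) auto
      have in': "\<sigma> g \<in> carrier (Aut_qt q)" if "g \<in> carrier G" for g
        using that Aut.m_closed[OF char_in \<sigma>_in[OF \<sigma>\<^sub>0]] char_in \<sigma>_in[OF \<sigma>\<^sub>0]
        by (simp add: \<sigma> Aut_qt_simps)
      have "\<sigma> \<in> hom G (Aut_qt q)"
      proof (rule homI)
        fix g h assume gh: "g \<in> carrier G" "h \<in> carrier G"
        have "\<sigma> (g \<otimes>\<^bsub>G\<^esub> h) = \<sigma> g \<circ> \<sigma> h"
          using gh f(1) comp[OF gh] by (simp add: \<sigma> mem_char_Z1)
        then show "\<sigma> (g \<otimes>\<^bsub>G\<^esub> h) = \<sigma> g \<otimes>\<^bsub>Aut_qt q\<^esub> \<sigma> h"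
          using gh in' by (simp add: Aut_qt_simps)
      qed (rule in')
      moreover have "lattice_part (\<sigma> g) = \<rho> g" if "g \<in> carrier G" for g
        using lattice_part_comp[OF q char_in[OF that] \<sigma>_in[OF \<sigma>\<^sub>0 that]]
        by (simp add: \<sigma>[OF that] lattice_part_char_aut[OF funcset_mem[OF Pi that]] \<sigma>_lat[OF \<sigma>\<^sub>0 that] comp_def)
      moreover have "\<sigma> \<in> extensional (carrier G)" unfolding f(2) by (simp add: twist_def)
      ultimately show "\<sigma> \<in> splittings q G \<rho>" by (simp add: splittings_def)
    next
      fix \<sigma> assume \<sigma>: "\<sigma> \<in> splittings q G \<rho>"
      have "\<exists>\<theta>\<in>carrier char_group. \<sigma> g = char_aut \<theta> \<circ> \<sigma>\<^sub>0 g" if g: "g \<in> carrier G" for g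
      proof -
        note in' = \<sigma>_in[OF \<sigma> g] \<sigma>_in[OF \<sigma>\<^sub>0 g]
        \<comment> \<open>The quotient of the two splittings at \<open>g\<close>; its lattice part
          is trivial, so it lies in the image of \<open>char_aut\<close>.\<close>
        let ?\<tau> = "\<sigma> g \<otimes>\<^bsub>Aut_qt q\<^esub> inv\<^bsub>Aut_qt q\<^esub> \<sigma>\<^sub>0 g"
        interpret lp: group_hom "Aut_qt q" "Aut_lam q" lattice_part
          using lattice_part_hom[OF q] group_Aut_qt group_Aut_lam
          by (simp add: group_hom_def group_hom_axioms_def)
        have "lattice_part ?\<tau> = \<rho> g \<otimes>\<^bsub>Aut_lam q\<^esub> inv\<^bsub>Aut_lam q\<^esub> \<rho> g"
          using in' g \<sigma> \<sigma>\<^sub>0 by (simp add: \<sigma>_lat)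
        also have "\<dots> = \<one>\<^bsub>Aut_lam q\<^esub>"
          using \<rho> g group.r_inv[OF group_Aut_lam] by (metis hom_in_carrier)
        finally have "?\<tau> \<in> kernel (Aut_qt q) (Aut_lam q) lattice_part" using in' by (simp add: kernel_def)
        then obtain \<theta> where \<theta>: "\<theta> \<in> carrier char_group" "?\<tau> = char_aut \<theta>"
          by (auto simp flip: char_aut_image[OF q])
        have "\<sigma> g = ?\<tau> \<otimes>\<^bsub>Aut_qt q\<^esub> \<sigma>\<^sub>0 g" using in' by (simp add: Aut.m_assoc)
        with \<theta> in' q have "\<sigma> g = char_aut \<theta> \<circ> \<sigma>\<^sub>0 g" by (simp add: Aut_qt_simps char_aut_in_Aut_qt)
        with \<theta> show ?thesis by blast
      qed
      then obtain f where f: "\<And>g. g \<in> carrier G \<Longrightarrow> f g \<in> carrier char_group"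
        "\<And>g. g \<in> carrier G \<Longrightarrow> \<sigma> g = char_aut (f g) \<circ> \<sigma>\<^sub>0 g" by metis
      have "f (g \<otimes>\<^bsub>G\<^esub> h) = (\<lambda>x. f g x * f h (\<rho> (inv\<^bsub>G\<^esub> g) x))" if gh: "g \<in> carrier G" "h \<in> carrier G" for g h
      proof (rule cancel[of _ "g \<otimes>\<^bsub>G\<^esub> h"])
        show "char_aut (f (g \<otimes>\<^bsub>G\<^esub> h)) \<circ> \<sigma>\<^sub>0 (g \<otimes>\<^bsub>G\<^esub> h) =
            char_aut (\<lambda>x. f g x * f h (\<rho> (inv\<^bsub>G\<^esub> g) x)) \<circ> \<sigma>\<^sub>0 (g \<otimes>\<^bsub>G\<^esub> h)"
          using gh f(2)[of g] f(2)[of h] f(2)[of "g \<otimes>\<^bsub>G\<^esub> h"] \<sigma>_mult[OF \<sigma> gh] comp[OF gh] by simp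
      qed (use gh f in auto)
      \<comment> \<open>The choice of \<open>f\<close> is controlled only on
        \<open>carrier G\<close>, while cocycles are extensional.\<close>
      then have "restrict f (carrier G) \<in> carrier (char_Z1 G \<rho>)"
        using f by (simp add: mem_char_Z1)
      moreover have "twist q G (restrict f (carrier G)) \<sigma>\<^sub>0 = \<sigma>"
      proof (rule extensionalityI[of _ "carrier G"])
        fix g assume "g \<in> carrier G"
        then show "twist q G (restrict f (carrier G)) \<sigma>\<^sub>0 g = \<sigma> g"
          using f twist[of "restrict f (carrier G)" g] by simp
      qed (use \<sigma> in \<open>simp_all add: twist_def splittings_def\<close>)
      ultimately show "\<sigma> \<in> (\<lambda>f. twist q G f \<sigma>\<^sub>0) ` carrier (char_Z1 G \<rho>)" by blast
    qed
  qed
qed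


section \<open>Matrices acting on the lattice\<close>

lemma mat2_vec_nth [simp]: "((A::int^2^2) *v x) $ i = A $ i $ 1 * x $ 1 + A $ i $ 2 * x $ 2"
  by (simp add: matrix_vector_mult_def sum_2)

lemma mat2_mult_nth [simp]: "((A::int^2^2) ** B) $ i $ j = A $ i $ 1 * B $ 1 $ j + A $ i $ 2 * B $ 2 $ j"
  by (simp add: matrix_matrix_mult_def sum_2)

definition mat2 :: "int \<Rightarrow> int \<Rightarrow> int \<Rightarrow> int \<Rightarrow> int^2^2" where
  "mat2 a b c d = vector [vector [a, b], vector [c, d]]"

lemma mat2_nth [simp]:
  "mat2 a b c d $ 1 $ 1 = a" "mat2 a b c d $ 1 $ 2 = b"
  "mat2 a b c d $ 2 $ 1 = c" "mat2 a b c d $ 2 $ 2 = d"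
  by (simp_all add: mat2_def)

lemma mat2_eq_iff:
  "(A::int^2^2) = B \<longleftrightarrow> A $ 1 $ 1 = B $ 1 $ 1 \<and> A $ 1 $ 2 = B $ 1 $ 2 \<and>
     A $ 2 $ 1 = B $ 2 $ 1 \<and> A $ 2 $ 2 = B $ 2 $ 2"
  by (auto simp: vec_eq_iff forall_2)

lemma mat_1_nth [simp]:
  "(mat 1 :: int^2^2) $ 1 $ 1 = 1" "(mat 1 :: int^2^2) $ 1 $ 2 = 0"
  "(mat 1 :: int^2^2) $ 2 $ 1 = 0" "(mat 1 :: int^2^2) $ 2 $ 2 = 1"
  by (simp_all add: mat_def)

lemma invertible_int_mat2_iff: "invertible (A::int^2^2) \<longleftrightarrow> det A = 1 \<or> det A = -1"
proof
  assume "invertible A"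
  then obtain B where "A ** B = mat 1" by (auto simp: invertible_def)
  then have "det A * det B = 1" by (metis det_I det_mul)
  then show "det A = 1 \<or> det A = -1" by (auto simp: zmult_eq_1_iff)
next
  assume "det A = 1 \<or> det A = -1"
  then have "det A * det A = 1" by auto
  \<comment> \<open>The candidate inverse is the adjugate times \<open>det A\<close>, since
    \<open>det A\<close> is its own inverse.\<close>
  then have "A ** mat2 (det A * A $ 2 $ 2) (- det A * A $ 1 $ 2) (- det A * A $ 2 $ 1) (det A * A $ 1 $ 1) = mat 1 \<and>
    mat2 (det A * A $ 2 $ 2) (- det A * A $ 1 $ 2) (- det A * A $ 2 $ 1) (det A * A $ 1 $ 1) ** A = mat 1"
    by (simp add: mat2_eq_iff) (simp add: det_2 algebra_simps)
  then show "invertible A" unfolding invertible_def by blast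
qed

lemma area_mat2:
  fixes A :: "int^2^2"
  shows "(A *v x) $ 1 * (A *v y) $ 2 - (A *v x) $ 2 * (A *v y) $ 1 = det A * (x $ 1 * y $ 2 - x $ 2 * y $ 1)"
  by (simp add: det_2 algebra_simps)

lemma additive_scale:
  fixes \<psi> :: "int^2 \<Rightarrow> int^2"
  assumes "\<And>x y. \<psi> (x + y) = \<psi> x + \<psi> y"
  shows "\<psi> (n *s x) = n *s \<psi> x"
proof (induction n rule: int_induct[where k = 0])
  case base
  show ?case using assms[of 0 0] by (simp add: vec_eq_iff)
next
  case (step1 i)
  then show ?case using assms[of "i *s x" x] by (simp add: vector_sadd_rdistrib)
next
  case (step2 i)
  have "i *s x = (i - 1) *s x + x" by (simp add: vec_eq_iff algebra_simps)
  then have "i *s \<psi> x = \<psi> ((i - 1) *s x) + \<psi> x" using step2 assms by metis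
  then show ?case by (simp add: vec_eq_iff algebra_simps)
qed

lemma additive_matrix:
  fixes \<psi> :: "int^2 \<Rightarrow> int^2"
  assumes "\<And>x y. \<psi> (x + y) = \<psi> x + \<psi> y"
  shows "\<psi> = (*v) (matrix \<psi>)"
proof
  fix x :: "int^2"
  have "x = x $ 1 *s axis 1 1 + x $ 2 *s axis 2 1" by (simp add: vec_eq_iff forall_2 axis_def)
  then have "\<psi> x = x $ 1 *s \<psi> (axis 1 1) + x $ 2 *s \<psi> (axis 2 1)"
    using assms additive_scale[OF assms] by metis
  then show "\<psi> x = matrix \<psi> *v x"
    by (simp add: vec_eq_iff matrix_def algebra_simps)
qed

lemma mat2_in_auto_Z2_iff: "(*v) (A::int^2^2) \<in> auto Z2 \<longleftrightarrow> invertible A"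
proof
  assume "(*v) A \<in> auto Z2"
  then have b: "bij ((*v) A)" by (simp add: auto_Z2_iff)
  define \<psi> where "\<psi> = inv_into UNIV ((*v) A)"
  have i: "A *v \<psi> x = x" "\<psi> (A *v x) = x" for x
    using b by (simp_all add: \<psi>_def bij_is_inj bij_is_surj surj_f_inv_f)
  have "\<psi> (x + y) = \<psi> x + \<psi> y" for x y
    by (metis i matrix_vector_right_distrib)
  then have \<psi>: "\<psi> = (*v) (matrix \<psi>)" by (rule additive_matrix)
  have "A ** matrix \<psi> = mat 1" "matrix \<psi> ** A = mat 1"
    by (metis \<psi> i matrix_eq matrix_vector_mul_assoc matrix_vector_mul_lid)+
  then show "invertible A" unfolding invertible_def by blast
next
  assume "invertible A"
  then obtain B where "A ** B = mat 1" "B ** A = mat 1" by (auto simp: invertible_def)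
  then have "(*v) B \<circ> (*v) A = id" "(*v) A \<circ> (*v) B = id"
    by (simp_all add: fun_eq_iff matrix_vector_mul_assoc)
  then have "bij ((*v) A)" by (rule o_bij)
  then show "(*v) A \<in> auto Z2" by (simp add: auto_Z2_iff matrix_vector_right_distrib)
qed

text \<open>A matrix multiplies the area form by its determinant, and the standard basis, of area 1,
  gives the converse. For nonzero q and determinant -1 the condition becomes q^2 = 1; this is where
  the two cases of the theorem separate.\<close>

lemma mat2_in_Aut_lam_iff:
  "(*v) (A::int^2^2) \<in> carrier (Aut_lam q) \<longleftrightarrow> invertible A \<and> q powi det A = q"
proof -
  have lam: "lam q (A *v x) (A *v y) = (q powi det A) powi (x $ 1 * y $ 2 - x $ 2 * y $ 1)" for x y
    by (simp only: lam_def area_mat2 power_int_mult)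
  have "(\<forall>x y. lam q (A *v x) (A *v y) = lam q x y) \<longleftrightarrow> q powi det A = q"
  proof
    assume "\<forall>x y. lam q (A *v x) (A *v y) = lam q x y"
    then have "lam q (A *v vector [1, 0]) (A *v vector [0, 1]) = lam q (vector [1, 0]) (vector [0, 1])" by blast
    then show "q powi det A = q" by (simp add: lam) (simp add: lam_def)
  qed (simp add: lam, simp add: lam_def)
  then show ?thesis by (simp add: Aut_lam_carrier_iff mat2_in_auto_Z2_iff)
qed

lemma GL2Z_simps [simp]:
  "carrier GL2Z = {A. invertible A}" "A \<otimes>\<^bsub>GL2Z\<^esub> B = A ** B" "\<one>\<^bsub>GL2Z\<^esub> = mat 1"
  by (simp_all add: GL2Z_def)

lemma SL2Z_simps [simp]:
  "carrier SL2Z = {A. det A = 1}" "A \<otimes>\<^bsub>SL2Z\<^esub> B = A ** B" "\<one>\<^bsub>SL2Z\<^esub> = mat 1"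
  by (simp_all add: SL2Z_def)

lemma group_GL2Z: "group GL2Z"
proof (rule groupI)
  fix A :: "int^2^2" assume "A \<in> carrier GL2Z"
  then obtain B where "A ** B = mat 1" "B ** A = mat 1" by (auto simp: invertible_def)
  then show "\<exists>B\<in>carrier GL2Z. B \<otimes>\<^bsub>GL2Z\<^esub> A = \<one>\<^bsub>GL2Z\<^esub>"
    by (intro bexI[of _ B]) (auto simp: invertible_def)
qed (auto simp: matrix_mul_assoc invertible_int_mat2_iff det_mul)

lemma group_SL2Z: "group SL2Z"
proof (rule groupI)
  fix A :: "int^2^2" assume A: "A \<in> carrier SL2Z"
  then obtain B where B: "B ** A = mat 1" using invertible_int_mat2_iff[of A] by (auto simp: invertible_def)
  then have "det B * det A = 1" by (metis det_I det_mul)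
  with A B show "\<exists>B\<in>carrier SL2Z. B \<otimes>\<^bsub>SL2Z\<^esub> A = \<one>\<^bsub>SL2Z\<^esub>"
    by (intro bexI[of _ B]) auto
qed (auto simp: matrix_mul_assoc det_mul)

lemma mat2_iso_Aut_lam:
  assumes "G = GL2Z \<and> q ^ 2 = 1 \<or> G = SL2Z \<and> q ^ 2 \<noteq> 1" "q \<noteq> 0"
  shows "(*v) \<in> iso G (Aut_lam q)"
proof -
  have inv: "inverse q = q \<longleftrightarrow> q ^ 2 = 1"
    using assms(2) by (auto simp: field_simps power2_eq_square)
  have mult: "A \<otimes>\<^bsub>G\<^esub> B = A ** B" for A B using assms by auto
  have carrier: "A \<in> carrier G \<longleftrightarrow> (*v) A \<in> carrier (Aut_lam q)" for A
    using assms inv by (auto simp: mat2_in_Aut_lam_iff invertible_int_mat2_iff power_int_minus)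
  have "(*v) \<in> hom G (Aut_lam q)"
    using carrier by (intro homI) (auto simp: mult Aut_lam_simps matrix_vector_mul_assoc)
  moreover have "inj_on (*v) (carrier G)"
    by (auto intro!: inj_onI simp: matrix_eq)
  moreover have "(*v) ` carrier G = carrier (Aut_lam q)"
  proof (intro equalityI subsetI)
    fix \<psi> assume \<psi>: "\<psi> \<in> carrier (Aut_lam q)"
    then have "\<psi> = (*v) (matrix \<psi>)" by (intro additive_matrix) (simp add: Aut_lam_carrier_iff auto_Z2_iff)
    with \<psi> show "\<psi> \<in> (*v) ` carrier G" by (metis carrier imageI)
  qed (use carrier in auto)
  ultimately show ?thesis by (simp add: iso_iff)
qed


section \<open>An explicit splitting\<close>

text \<open>Modulo 2, \<open>arf\<close> is the quadratic form of Arf invariant 1; being the only one with its polarization,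
  it is invariant under \<open>GL\<^sub>2\<close>. This is what makes the following exponent an integer.\<close>

definition arf :: "int^2 \<Rightarrow> int" where
  "arf x = x $ 1 * x $ 2 + x $ 1 + x $ 2"

definition split_exp :: "int^2^2 \<Rightarrow> int^2 \<Rightarrow> int" where
  "split_exp A x = (arf (A *v x) - det A * arf x) div 2"

text \<open>Identities for \<open>split_exp\<close> are proved after doubling, where this equation
  removes the division.\<close>

lemma two_split_exp:
  assumes "odd (det A)"
  shows "2 * split_exp A x = arf (A *v x) - det A * arf x"
proof -
  have "even (arf (A *v x) - det A * arf x)"
    using assms by (auto simp: arf_def det_2)
  then show ?thesis by (simp add: split_exp_def)
qed

text \<open>Twice x1 y2 is the polarization of \<open>arf\<close> plus the area form. Under A the
  area form acquires the factor \<open>det A\<close> and drops out of the difference, so the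
  polarizations account for everything. Once \<open>q powi det A = q\<close>, this is the twisting
  condition written in exponents.\<close>

lemma split_exp_add:
  assumes "odd (det A)"
  shows "split_exp A (x + y) + det A * (x $ 1 * y $ 2) = split_exp A x + split_exp A y + (A *v x) $ 1 * (A *v y) $ 2"
proof -
  have "2 * (split_exp A (x + y) + det A * (x $ 1 * y $ 2)) =
      2 * (split_exp A x + split_exp A y + (A *v x) $ 1 * (A *v y) $ 2)"
    unfolding distrib_left two_split_exp[OF assms] by (simp add: arf_def det_2 algebra_simps)
  then show ?thesis by simp
qed

text \<open>The difference of forms telescopes through \<open>arf (B *v x)\<close>. The weight
  \<open>det A\<close> disappears in \<open>split_aut_mult\<close>, again by
  \<open>q powi det A = q\<close>.\<close>

lemma split_exp_mult:
  assumes "odd (det A)" "odd (det B)"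
  shows "split_exp (A ** B) x = split_exp A (B *v x) + det A * split_exp B x"
proof -
  have AB: "odd (det (A ** B))" using assms by (simp add: det_mul)
  have "2 * split_exp (A ** B) x = 2 * split_exp A (B *v x) + det A * (2 * split_exp B x)"
    unfolding two_split_exp[OF assms(1)] two_split_exp[OF assms(2)] two_split_exp[OF AB]
    by (simp add: matrix_vector_mul_assoc det_mul algebra_simps)
  then show ?thesis by simp
qed

definition split_aut :: "'k::field \<Rightarrow> int^2^2 \<Rightarrow> (int^2 \<Rightarrow>\<^sub>0 'k) \<Rightarrow> (int^2 \<Rightarrow>\<^sub>0 'k)" where
  "split_aut q A = mono_map (\<lambda>x. q powi split_exp A x) ((*v) A)"

lemma split_aut:
  assumes "q \<noteq> 0" "(*v) A \<in> carrier (Aut_lam q)"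
  shows "split_aut q A \<in> carrier (Aut_qt q)" "lattice_part (split_aut q A) = (*v) A"
proof -
  have odd: "odd (det A)" and q: "q powi det A = q"
    using assms(2) by (auto simp: mat2_in_Aut_lam_iff invertible_int_mat2_iff)
  have auto: "(*v) A \<in> auto Z2" using assms(2) by (simp add: Aut_lam_carrier_iff)
  have "q powi split_exp A (x + y) * q powi (x $ 1 * y $ 2) =
      q powi split_exp A x * q powi split_exp A y * q powi ((A *v x) $ 1 * (A *v y) $ 2)" for x y
  proof -
    have "q powi (x $ 1 * y $ 2) = q powi (det A * (x $ 1 * y $ 2))" by (simp only: power_int_mult q)
    then show ?thesis using assms(1) split_exp_add[OF odd, of x y]
      by (simp only: power_int_add[symmetric] simp_thms)
  qed
  then have "twisted_char q ((*v) A) (\<lambda>x. q powi split_exp A x)"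
    using assms(1) by (simp add: twisted_char_def del: mat2_vec_nth)
  then show "split_aut q A \<in> carrier (Aut_qt q)" unfolding split_aut_def by (rule mono_map_in_Aut_qt[OF assms(1) auto])
  show "lattice_part (split_aut q A) = (*v) A"
    unfolding split_aut_def using assms(1) by (intro lattice_part_mono_map[OF auto]) simp
qed

lemma split_aut_mult:
  assumes "q \<noteq> 0" "(*v) A \<in> carrier (Aut_lam q)" "(*v) B \<in> carrier (Aut_lam q)"
  shows "split_aut q (A ** B) = split_aut q A \<circ> split_aut q B"
proof -
  have odd: "odd (det A)" "odd (det B)" and q: "q powi det A = q"
    using assms by (auto simp: mat2_in_Aut_lam_iff invertible_int_mat2_iff)
  have "bij ((*v) A)" "bij ((*v) B)" using assms by (simp_all add: Aut_lam_carrier_iff auto_Z2_iff)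
  then have "split_aut q A \<circ> split_aut q B =
      mono_map (\<lambda>x. q powi split_exp B x * q powi split_exp A (B *v x)) ((*v) A \<circ> (*v) B)"
    by (simp add: split_aut_def mono_map_comp)
  also have "(*v) A \<circ> (*v) B = (*v) (A ** B)" by (simp add: fun_eq_iff matrix_vector_mul_assoc)
  also have "(\<lambda>x. q powi split_exp B x * q powi split_exp A (B *v x)) = (\<lambda>x. q powi split_exp (A ** B) x)"
  proof
    fix x
    have "q powi split_exp B x = q powi (det A * split_exp B x)" by (simp only: power_int_mult q)
    then show "q powi split_exp B x * q powi split_exp A (B *v x) = q powi split_exp (A ** B) x"
      using assms(1) by (simp add: split_exp_mult[OF odd] power_int_add)
  qed
  finally show ?thesis by (simp only: split_aut_def[of q "A ** B"])
qed

text \<open>Working over \<open>Aut_lam q\<close> and reading off matrices treats q^2 = 1 and q^2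
  \<noteq> 1 at once: membership enters only through an odd determinant and
  \<open>q powi det A = q\<close>.\<close>

lemma split_aut_splitting:
  assumes "q \<noteq> 0"
  shows "(\<lambda>\<psi>\<in>carrier (Aut_lam q). split_aut q (matrix \<psi>)) \<in> splittings q (Aut_lam q) (\<lambda>\<psi>. \<psi>)"
    (is "?\<sigma> \<in> _")
proof -
  have mat: "\<psi> = (*v) (matrix \<psi>)" if "\<psi> \<in> carrier (Aut_lam q)" for \<psi>
    using that by (intro additive_matrix) (simp add: Aut_lam_carrier_iff auto_Z2_iff)
  have split: "split_aut q (matrix \<psi>) \<in> carrier (Aut_qt q)" "lattice_part (split_aut q (matrix \<psi>)) = \<psi>"
    if "\<psi> \<in> carrier (Aut_lam q)" for \<psi>
    using split_aut[OF assms, of "matrix \<psi>"] that by (simp_all add: mat[OF that, symmetric])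
  have "?\<sigma> \<in> hom (Aut_lam q) (Aut_qt q)"
  proof (rule homI)
    fix \<psi> \<psi>' assume *: "\<psi> \<in> carrier (Aut_lam q)" "\<psi>' \<in> carrier (Aut_lam q)"
    have in': "\<psi> \<otimes>\<^bsub>Aut_lam q\<^esub> \<psi>' \<in> carrier (Aut_lam q)"
      by (rule monoid.m_closed[OF group.is_monoid[OF group_Aut_lam] *])
    have "(*v) (matrix (\<psi> \<otimes>\<^bsub>Aut_lam q\<^esub> \<psi>')) = \<psi> \<circ> \<psi>'"
      by (rule trans[OF mat[OF in', symmetric] Aut_lam_simps(1)[OF *]])
    also have "\<dots> = (*v) (matrix \<psi>) \<circ> (*v) (matrix \<psi>')"
      by (simp only: mat[OF *(1), symmetric] mat[OF *(2), symmetric])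
    also have "\<dots> = (*v) (matrix \<psi> ** matrix \<psi>')"
      by (simp only: fun_eq_iff comp_apply matrix_vector_mul_assoc simp_thms)
    finally have "(*v) (matrix (\<psi> \<otimes>\<^bsub>Aut_lam q\<^esub> \<psi>')) = (*v) (matrix \<psi> ** matrix \<psi>')" .
    then have "matrix (\<psi> \<otimes>\<^bsub>Aut_lam q\<^esub> \<psi>') = matrix \<psi> ** matrix \<psi>'"
      by (simp add: matrix_eq fun_eq_iff)
    then have "?\<sigma> (\<psi> \<otimes>\<^bsub>Aut_lam q\<^esub> \<psi>') = split_aut q (matrix \<psi>) \<circ> split_aut q (matrix \<psi>')"
      using in' * split_aut_mult[OF assms, of "matrix \<psi>" "matrix \<psi>'"]
      by (simp add: mat[OF *(1), symmetric] mat[OF *(2), symmetric])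
    then show "?\<sigma> (\<psi> \<otimes>\<^bsub>Aut_lam q\<^esub> \<psi>') = ?\<sigma> \<psi> \<otimes>\<^bsub>Aut_qt q\<^esub> ?\<sigma> \<psi>'"
      using * split by (simp add: Aut_qt_simps)
  qed (simp add: split)
  then show ?thesis by (simp add: splittings_def split)
qed

lemma short_exact_Aut_qt:
  assumes "q \<noteq> 0"
  shows "short_exact char_group (Aut_qt q) (Aut_lam q) char_aut lattice_part"
proof -
  \<comment> \<open>Surjectivity is read off from the splitting, whose value at psi is a preimage of
    psi.\<close>
  have "\<psi> \<in> lattice_part ` carrier (Aut_qt q)" if "\<psi> \<in> carrier (Aut_lam q)" for \<psi>
    using split_aut_splitting[OF assms] that by (force simp: splittings_def hom_def)
  then have "lattice_part \<in> epi (Aut_qt q) (Aut_lam q)"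
    using assms by (auto simp: epi_def lattice_part_hom lattice_part_in_Aut_lam)
  then show ?thesis
    by (simp add: short_exact_def char_aut_mon[OF assms] char_aut_image[OF assms] group_Aut_qt group_Aut_lam
        comm_group.axioms(2)[OF comm_group_char_group])
qed


section \<open>The group of cocycles\<close>

lemma comm_group_Z1:
  assumes "group G" "comm_group M" and act: "\<And>x. x \<in> carrier G \<Longrightarrow> act x \<in> hom M M"
  shows "comm_group (Z1 G M act)"
proof -
  interpret G: group G by fact
  interpret M: comm_group M by fact
  have act_in: "act x m \<in> carrier M" if "x \<in> carrier G" "m \<in> carrier M" for x m
    by (rule hom_in_carrier[OF act[OF that(1)] that(2)])
  have act_mult: "act x (m \<otimes>\<^bsub>M\<^esub> n) = act x m \<otimes>\<^bsub>M\<^esub> act x n"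
    if "x \<in> carrier G" "m \<in> carrier M" "n \<in> carrier M" for x m n
    by (rule hom_mult[OF act[OF that(1)] that(2,3)])
  have act_one: "act x \<one>\<^bsub>M\<^esub> = \<one>\<^bsub>M\<^esub>" if "x \<in> carrier G" for x
    using hom_one[OF act[OF that] M.is_group M.is_group] .
  have mem: "f \<in> carrier (Z1 G M act) \<longleftrightarrow> f \<in> extensional (carrier G) \<and> (\<forall>x\<in>carrier G. f x \<in> carrier M) \<and>
      (\<forall>x\<in>carrier G. \<forall>y\<in>carrier G. f (x \<otimes>\<^bsub>G\<^esub> y) = f x \<otimes>\<^bsub>M\<^esub> act x (f y))" for f
    by (auto simp: Z1_def PiE_def)
  have mult: "f \<otimes>\<^bsub>Z1 G M act\<^esub> f' = (\<lambda>x\<in>carrier G. f x \<otimes>\<^bsub>M\<^esub> f' x)" for f f'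
    by (simp add: Z1_def)
  have one: "\<one>\<^bsub>Z1 G M act\<^esub> = (\<lambda>x\<in>carrier G. \<one>\<^bsub>M\<^esub>)"
    by (simp add: Z1_def)
  show ?thesis
  proof (rule comm_groupI)
    fix f f' assume "f \<in> carrier (Z1 G M act)" "f' \<in> carrier (Z1 G M act)"
    then show "f \<otimes>\<^bsub>Z1 G M act\<^esub> f' \<in> carrier (Z1 G M act)"
      by (simp add: mem mult act_in act_mult M.m_ac)
  next
    show "\<one>\<^bsub>Z1 G M act\<^esub> \<in> carrier (Z1 G M act)"
      by (simp add: mem one act_one)
  next
    fix f assume f: "f \<in> carrier (Z1 G M act)"
    then show "\<one>\<^bsub>Z1 G M act\<^esub> \<otimes>\<^bsub>Z1 G M act\<^esub> f = f"
      by (intro extensionalityI[of _ "carrier G"]) (simp_all add: mem mult one)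
    define f' where "f' = (\<lambda>x\<in>carrier G. inv\<^bsub>M\<^esub> f x)"
    have "act x (inv\<^bsub>M\<^esub> m) = inv\<^bsub>M\<^esub> act x m" if "x \<in> carrier G" "m \<in> carrier M" for x m
      using group_hom.hom_inv[of M M "act x" m] that act M.is_group
      by (simp add: group_hom_def group_hom_axioms_def)
    then have "f' \<in> carrier (Z1 G M act)"
      using f by (simp add: mem f'_def M.inv_mult act_in)
    moreover have "f' \<otimes>\<^bsub>Z1 G M act\<^esub> f = \<one>\<^bsub>Z1 G M act\<^esub>"
      using f by (intro extensionalityI[of _ "carrier G"]) (simp_all add: mem mult one f'_def)
    ultimately show "\<exists>f'\<in>carrier (Z1 G M act). f' \<otimes>\<^bsub>Z1 G M act\<^esub> f = \<one>\<^bsub>Z1 G M act\<^esub>" by blast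
  next
    fix f f' f'' assume "f \<in> carrier (Z1 G M act)" "f' \<in> carrier (Z1 G M act)" "f'' \<in> carrier (Z1 G M act)"
    then show "f \<otimes>\<^bsub>Z1 G M act\<^esub> f' \<otimes>\<^bsub>Z1 G M act\<^esub> f'' = f \<otimes>\<^bsub>Z1 G M act\<^esub> (f' \<otimes>\<^bsub>Z1 G M act\<^esub> f'')"
      by (intro extensionalityI[of _ "carrier G"]) (simp_all add: mem mult M.m_assoc)
  next
    fix f f' assume "f \<in> carrier (Z1 G M act)" "f' \<in> carrier (Z1 G M act)"
    then show "f \<otimes>\<^bsub>Z1 G M act\<^esub> f' = f' \<otimes>\<^bsub>Z1 G M act\<^esub> f"
      by (intro extensionalityI[of _ "carrier G"]) (simp_all add: mem mult M.m_comm)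
  qed
qed

lemma comm_group_char_Z1:
  fixes G :: "(int^2^2) monoid"
  assumes "group G"
  shows "comm_group (char_Z1 G (*v) :: (int^2^2 \<Rightarrow> int^2 \<Rightarrow> 'k::field) monoid)"
  unfolding char_Z1_def
proof (rule comm_group_Z1[OF assms comm_group_char_group])
  fix A
  show "char_act G (*v) A \<in> hom char_group (char_group :: (int^2 \<Rightarrow> 'k) monoid)"
    by (rule homI)
      (simp_all add: mem_char_group char_act_def matrix_vector_right_distrib, simp add: char_group_def comp_def)
qed

abbreviation e\<^sub>1 :: "int^2" where "e\<^sub>1 \<equiv> vector [1, 0]"
abbreviation e\<^sub>2 :: "int^2" where "e\<^sub>2 \<equiv> vector [0, 1]"

lemma char_eval:
  fixes \<theta> :: "int^2 \<Rightarrow> 'k::field"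
  assumes "\<theta> \<in> carrier char_group"
  shows "\<theta> x = \<theta> e\<^sub>1 powi (x $ 1) * \<theta> e\<^sub>2 powi (x $ 2)"
proof -
  have nz: "\<theta> x \<noteq> 0" and add: "\<theta> (x + y) = \<theta> x * \<theta> y" for x y
    using assms by (simp_all add: mem_char_group)
  have scale: "\<theta> (n *s x) = \<theta> x powi n" for n x
  proof (induction n rule: int_induct[where k = 0])
    case base
    show ?case using add[of 0 0] nz[of 0] by simp
  next
    case (step1 i)
    then show ?case using add[of "i *s x" x] nz[of x] by (simp add: vector_sadd_rdistrib power_int_add)
  next
    case (step2 i)
    have "i *s x = (i - 1) *s x + x" by (simp add: vec_eq_iff algebra_simps)
    then have "\<theta> x powi i = \<theta> ((i - 1) *s x) * \<theta> x" using step2 add by metis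
    then show ?case using nz[of x] by (simp add: power_int_diff)
  qed
  have "x = x $ 1 *s e\<^sub>1 + x $ 2 *s e\<^sub>2" by (simp add: vec_eq_iff forall_2)
  then show ?thesis using add scale by metis
qed

lemma char_eqI:
  assumes "\<theta> \<in> carrier char_group" "\<theta>' \<in> carrier char_group" "\<theta> e\<^sub>1 = \<theta>' e\<^sub>1" "\<theta> e\<^sub>2 = \<theta>' e\<^sub>2"
  shows "\<theta> = \<theta>'"
  using char_eval[OF assms(1)] char_eval[OF assms(2)] assms(3,4) by (intro ext) metis

section \<open>Generation of SL_2(Z) by Euclid's algorithm\<close>

definition S :: "int^2^2" where "S = mat2 0 (-1) 1 0"
definition T :: "int^2^2" where "T = mat2 1 1 0 1"
definition P :: "int^2^2" where "P = mat2 0 1 1 0"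

lemma det_mat2 [simp]: "det (mat2 a b c d) = a * d - b * c"
  by (simp add: det_2)

lemma det_generators [simp]: "det S = 1" "det T = 1" "det P = -1"
  by (simp_all add: S_def T_def P_def)

text \<open>Euclid's algorithm on the first column. The hypotheses are equivalences so that inverses
  of the generators, in particular negative powers of \<open>T\<close>, are covered as well.\<close>

lemma SL2Z_induct:
  assumes "det A = 1" "Q (mat 1)"
    and S: "\<And>B. det B = 1 \<Longrightarrow> Q (S ** B) \<longleftrightarrow> Q B" and T: "\<And>B. det B = 1 \<Longrightarrow> Q (T ** B) \<longleftrightarrow> Q B"
  shows "Q A"
proof -
  have shear: "Q (mat2 1 k 0 1 ** B) \<longleftrightarrow> Q B" if "det B = 1" for k B
  proof (induction k rule: int_induct[where k = 0])
    case base
    have "mat2 1 0 0 1 ** B = B" by (simp add: mat2_eq_iff)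
    then show ?case by simp
  next
    case (step1 i)
    have "mat2 1 (i + 1) 0 1 ** B = T ** (mat2 1 i 0 1 ** B)" by (simp add: mat2_eq_iff T_def algebra_simps)
    then show ?case using T[of "mat2 1 i 0 1 ** B"] step1 that by (simp add: det_mul)
  next
    case (step2 i)
    have "mat2 1 i 0 1 ** B = T ** (mat2 1 (i - 1) 0 1 ** B)" by (simp add: mat2_eq_iff T_def algebra_simps)
    then show ?case using T[of "mat2 1 (i - 1) 0 1 ** B"] step2 that by (simp add: det_mul)
  qed
  show ?thesis using assms(1)
  proof (induction "nat \<bar>A $ 2 $ 1\<bar>" arbitrary: A rule: less_induct)
    case less
    show ?case
    proof (cases "A $ 2 $ 1 = 0")
      case True
      then have "A $ 1 $ 1 * A $ 2 $ 2 = 1" using less.prems by (simp add: det_2)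
      then consider "A $ 1 $ 1 = 1" "A $ 2 $ 2 = 1" | "A $ 1 $ 1 = -1" "A $ 2 $ 2 = -1"
        by (auto simp: zmult_eq_1_iff)
      then show ?thesis
      proof cases
        case 1
        with True have "A = mat2 1 (A $ 1 $ 2) 0 1 ** mat 1" by (simp add: mat2_eq_iff)
        then show ?thesis using shear[of "mat 1" "A $ 1 $ 2"] assms(2) by simp
      next
        case 2
        \<comment> \<open>\<open>S ** S\<close> is minus the identity, which reduces this case to a
          shear.\<close>
        with True have "A = S ** (S ** (mat2 1 (- A $ 1 $ 2) 0 1 ** mat 1))" by (simp add: mat2_eq_iff S_def)
        then show ?thesis
          using shear[of "mat 1" "- A $ 1 $ 2"] assms(2) S[of "mat2 1 (- A $ 1 $ 2) 0 1 ** mat 1"]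
            S[of "S ** (mat2 1 (- A $ 1 $ 2) 0 1 ** mat 1)"] by (simp add: det_mul)
      qed
    next
      case False
      \<comment> \<open>Subtracting \<open>k\<close> times the second row from the first leaves the
        remainder in the upper left corner, and \<open>S\<close> moves it to the lower left, where
        it is smaller than the old entry.\<close>
      define k where "k = A $ 1 $ 1 div A $ 2 $ 1"
      define B where "B = mat2 1 (- k) 0 1 ** A"
      have det: "det B = 1" using less.prems by (simp add: B_def det_mul)
      have "(S ** B) $ 2 $ 1 = A $ 1 $ 1 mod A $ 2 $ 1"
        by (simp add: S_def B_def k_def minus_div_mult_eq_mod[symmetric])
      then have "Q (S ** B)" using False det
        by (intro less.hyps) (simp_all add: det_mul nat_less_iff abs_mod_less)
      then have "Q B" using S[OF det] by simp
      then show ?thesis using shear[OF less.prems, of "- k"] by (simp add: B_def)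
    qed
  qed
qed

text \<open>Modulo 4, \<open>hex_form \<circ> A\<close> agrees with \<open>hex_polar A \<cdot> hex_form\<close> up to twice the square of a linear form,
  and \<open>hex_exp A\<close> is this linear form modulo 2. It is a cocycle but not a coboundary; it corresponds to
  \<open>PSL\<^sub>2(\<int>/4) \<cong> S\<^sub>4\<close> being the affine group of the plane over \<open>\<F>\<^sub>2\<close>.\<close>

definition hex_form :: "int^2 \<Rightarrow> int" where
  "hex_form x = x $ 1 * x $ 1 + x $ 1 * x $ 2 + x $ 2 * x $ 2"

text \<open>The coefficient of x1 x2 in \<open>hex_form (A *v x)\<close>. With this multiplier the
  difference in \<open>hex_exp\<close> contains only the squares x1^2 and x2^2.\<close>

definition hex_polar :: "int^2^2 \<Rightarrow> int" where
  "hex_polar A = 2 * (A $ 1 $ 1 * A $ 1 $ 2) + A $ 1 $ 1 * A $ 2 $ 2 + A $ 1 $ 2 * A $ 2 $ 1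
     + 2 * (A $ 2 $ 1 * A $ 2 $ 2)"

definition hex_exp :: "int^2^2 \<Rightarrow> int^2 \<Rightarrow> int" where
  "hex_exp A x = (hex_form (A *v x) - hex_polar A * hex_form x) div 2"

lemma two_hex_exp:
  assumes "odd (det A)"
  shows "2 * hex_exp A x = hex_form (A *v x) - hex_polar A * hex_form x"
proof -
  have "even (hex_form (A *v x) - hex_polar A * hex_form x)"
    using assms by (auto simp: hex_form_def hex_polar_def det_2)
  then show ?thesis by (simp add: hex_exp_def)
qed

lemma odd_hex:
  assumes "odd (det A)"
  shows "odd (hex_polar A)" "odd (hex_form (A *v e\<^sub>1))" "odd (hex_form (A *v e\<^sub>2))"
  using assms by (auto simp: hex_polar_def hex_form_def det_2)

text \<open>The mixed terms cancel by the choice of \<open>hex_polar\<close>. What remains are the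
  cross terms of the two squares, whose coefficients are differences of odd numbers.\<close>

lemma hex_exp_add:
  assumes "odd (det A)"
  shows "even (hex_exp A (x + y) - (hex_exp A x + hex_exp A y))"
proof -
  have "2 * (hex_exp A (x + y) - (hex_exp A x + hex_exp A y)) =
    2 * ((hex_form (A *v e\<^sub>1) - hex_polar A) * (x $ 1 * y $ 1) + (hex_form (A *v e\<^sub>2) - hex_polar A) * (x $ 2 * y $ 2))"
    unfolding right_diff_distrib distrib_left[of _ "hex_exp A x"] two_hex_exp[OF assms]
    by (simp add: hex_form_def hex_polar_def algebra_simps)
  then have "hex_exp A (x + y) - (hex_exp A x + hex_exp A y) =
    (hex_form (A *v e\<^sub>1) - hex_polar A) * (x $ 1 * y $ 1) + (hex_form (A *v e\<^sub>2) - hex_polar A) * (x $ 2 * y $ 2)"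
    by simp
  then show ?thesis using odd_hex[OF assms] by simp
qed

text \<open>Here \<open>hex_polar\<close> is odd and multiplicative modulo 4, so after halving its
  values act as 1 modulo 2. The order of the factors fits \<open>param_cocycle\<close>, which
  evaluates \<open>hex_exp\<close> at inverses.\<close>

lemma hex_exp_mult:
  assumes "odd (det A)" "odd (det B)"
  shows "even (hex_exp (B ** A) x - (hex_exp A x + hex_exp B (A *v x)))"
proof -
  have BA: "odd (det (B ** A))" using assms by (simp add: det_mul)
  have polar: "hex_polar (B ** A) = hex_polar B * hex_polar A
      + 2 * (hex_form (B *v e\<^sub>1) - hex_polar B) * (A $ 1 $ 1 * A $ 1 $ 2)
      + 2 * (hex_form (B *v e\<^sub>2) - hex_polar B) * (A $ 2 $ 1 * A $ 2 $ 2)"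
    by (simp add: hex_polar_def hex_form_def algebra_simps)
  have "2 * (hex_exp A x + hex_exp B (A *v x) - hex_exp (B ** A) x) =
      (1 - hex_polar B) * (hex_form (A *v x) - hex_polar A * hex_form x)
        + (hex_polar (B ** A) - hex_polar B * hex_polar A) * hex_form x"
    unfolding right_diff_distrib[of 2] distrib_left[of 2] two_hex_exp[OF assms(1)] two_hex_exp[OF assms(2)] two_hex_exp[OF BA]
    by (simp add: algebra_simps matrix_vector_mul_assoc del: mat2_vec_nth)
  also have "\<dots> = (1 - hex_polar B) * (2 * hex_exp A x)
      + (hex_polar (B ** A) - hex_polar B * hex_polar A) * hex_form x"
    by (simp only: two_hex_exp[OF assms(1)])
  also have "\<dots> = 2 * ((1 - hex_polar B) * hex_exp A x
      + ((hex_form (B *v e\<^sub>1) - hex_polar B) * (A $ 1 $ 1 * A $ 1 $ 2)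
      + (hex_form (B *v e\<^sub>2) - hex_polar B) * (A $ 2 $ 1 * A $ 2 $ 2)) * hex_form x)"
    unfolding polar by (simp add: algebra_simps del: mat2_vec_nth)
  finally have "hex_exp A x + hex_exp B (A *v x) - hex_exp (B ** A) x = (1 - hex_polar B) * hex_exp A x
      + ((hex_form (B *v e\<^sub>1) - hex_polar B) * (A $ 1 $ 1 * A $ 1 $ 2)
      + (hex_form (B *v e\<^sub>2) - hex_polar B) * (A $ 2 $ 1 * A $ 2 $ 2)) * hex_form x"
    by (simp only: mult_cancel_left) simp
  then have "even (hex_exp A x + hex_exp B (A *v x) - hex_exp (B ** A) x)"
    using odd_hex[OF assms(2)] by (simp del: mat2_vec_nth)
  then show ?thesis by (simp del: mat2_vec_nth) 
qed

lemma powi_cong_even: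
  fixes z :: "'k::field"
  assumes "z ^ 2 = 1" "even (m - n)"
  shows "z powi m = z powi n"
proof -
  obtain k where "m = n + 2 * k" using assms(2) by (metis add_diff_cancel_left' dvdE diff_add_cancel add.commute)
  moreover have "z \<noteq> 0" using assms(1) by auto
  moreover have "z powi (2 * k) = 1" using assms(1) by (simp add: power_int_mult)
  ultimately show ?thesis by (simp add: power_int_add)
qed


text \<open>The two matrices are the inverses of \<open>S\<close> and \<open>T\<close>, as in
  \<open>inv_generators\<close>.\<close>

lemma hex_exp_values:
  "hex_exp (mat2 0 1 (-1) 0) e\<^sub>2 = 1" "hex_exp (mat2 1 (-1) 0 1) e\<^sub>1 = 1" "hex_exp (mat2 1 (-1) 0 1) e\<^sub>2 = 1"
  by (simp_all add: hex_exp_def hex_form_def hex_polar_def)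

section \<open>The two parameter groups\<close>

lemma SL_params_simps [simp]:
  "((b, d), z) \<in> carrier SL_params \<longleftrightarrow> b \<noteq> 0 \<and> d \<noteq> 0 \<and> z ^ 2 = 1"
  "((b, d), z) \<otimes>\<^bsub>SL_params\<^esub> ((b', d'), z') = ((b * b', d * d'), z * z')"
  by (auto simp: SL_params_def unit_group_def DirProd_def)

lemma GL_params_simps [simp]:
  "(r\<^sub>0, r\<^sub>1, r\<^sub>2) \<in> carrier GL_params \<longleftrightarrow> r\<^sub>0 \<noteq> 0 \<and> r\<^sub>1 \<noteq> 0 \<and> r\<^sub>2 \<noteq> 0 \<and> r\<^sub>2 ^ 4 * r\<^sub>0 ^ 2 = r\<^sub>1 ^ 2"
  "(r\<^sub>0, r\<^sub>1, r\<^sub>2) \<otimes>\<^bsub>GL_params\<^esub> (s\<^sub>0, s\<^sub>1, s\<^sub>2) = (r\<^sub>0 * s\<^sub>0, r\<^sub>1 * s\<^sub>1, r\<^sub>2 * s\<^sub>2)"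
  by (simp_all add: GL_params_def unit_group_def DirProd_def)

text \<open>The equation of \<open>GL_params\<close> states that a quotient squares to 1, and this
  quotient is the sign. In terms of a cocycle, \<open>r\<^sub>1\<close> is the product of
  \<open>f S e\<^sub>1\<close> and \<open>f T e\<^sub>1\<close>, by
  \<open>cocycle_relations\<close>.\<close>

lemma SL_params_iso_GL_params: "(SL_params :: (('k::field \<times> 'k) \<times> 'k) monoid) \<cong> (GL_params :: ('k \<times> 'k \<times> 'k) monoid)"
proof (rule is_isoI)
  let ?h = "\<lambda>((b, d), z). (b, z * d ^ 2 * b, d) :: 'k \<times> 'k \<times> 'k"
  have z: "z \<noteq> 0" if "z ^ 2 = 1" for z :: 'k using that by auto
  have closed: "?h p \<in> carrier GL_params" if p: "p \<in> carrier SL_params" for p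
  proof -
    obtain b d w where "p = ((b, d), w)" by (metis surj_pair)
    with p z[of w] show ?thesis by (simp add: power_mult_distrib flip: power_mult)
  qed
  have "?h \<in> hom SL_params GL_params"
  proof (rule homI)
    fix p p' :: "('k \<times> 'k) \<times> 'k"
    show "?h (p \<otimes>\<^bsub>SL_params\<^esub> p') = ?h p \<otimes>\<^bsub>GL_params\<^esub> ?h p'"
      by (cases p; cases p'; cases "fst p"; cases "fst p'") (simp add: power_mult_distrib)
  qed (rule closed)
  moreover have "bij_betw ?h (carrier SL_params) (carrier GL_params)"
  proof (rule bij_betw_byWitness[where f' = "\<lambda>(r\<^sub>0, r\<^sub>1, r\<^sub>2). ((r\<^sub>0, r\<^sub>2), r\<^sub>1 / (r\<^sub>2 ^ 2 * r\<^sub>0))"])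
    show "?h ` carrier SL_params \<subseteq> carrier GL_params"
      using closed by blast
  qed (auto simp: power_divide power_mult_distrib simp flip: power_mult)
  ultimately show "?h \<in> iso SL_params GL_params" by (simp add: iso_def)
qed

text \<open>Both groups contain SL_2(Z) and have only determinants 1 and -1, which allows a common
  treatment; for \<open>SL2Z\<close> the case of determinant -1 is vacuous.\<close>

locale lattice_matrix_group =
  fixes G :: "(int^2^2) monoid"
  assumes G: "G = GL2Z \<or> G = SL2Z"
begin

lemma G_simps [simp]: "A \<otimes>\<^bsub>G\<^esub> B = A ** B" "\<one>\<^bsub>G\<^esub> = mat 1"
  using G by auto

lemma group_G: "group G"
  using G group_GL2Z group_SL2Z by auto

lemma SL2Z_subset: "det A = 1 \<Longrightarrow> A \<in> carrier G"
  using G by (auto simp: invertible_int_mat2_iff)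

lemma det_G: "A \<in> carrier G \<Longrightarrow> det A = 1 \<or> det A = -1"
  using G by (auto simp: invertible_int_mat2_iff)

lemma P_in_G: "A \<in> carrier G \<Longrightarrow> det A = -1 \<Longrightarrow> P \<in> carrier G"
  using G by (auto simp: invertible_int_mat2_iff)

lemma mult_in_G: "A \<in> carrier G \<Longrightarrow> B \<in> carrier G \<Longrightarrow> A ** B \<in> carrier G"
  using monoid.m_closed[OF group.is_monoid[OF group_G]] by simp

lemma inv_in_G: "A \<in> carrier G \<Longrightarrow> inv\<^bsub>G\<^esub> A \<in> carrier G"
  by (rule group.inv_closed[OF group_G])

lemma inv_G: "A \<in> carrier G \<Longrightarrow> inv\<^bsub>G\<^esub> A ** A = mat 1" "A \<in> carrier G \<Longrightarrow> A ** inv\<^bsub>G\<^esub> A = mat 1"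
  using group.l_inv[OF group_G] group.r_inv[OF group_G] by simp_all

lemma inv_G_vec: "A \<in> carrier G \<Longrightarrow> inv\<^bsub>G\<^esub> A *v (A *v x) = x"
  using inv_G(1)[of A] by (simp only: matrix_vector_mul_assoc matrix_vector_mul_lid)

lemma inv_eqI: "A \<in> carrier G \<Longrightarrow> B \<in> carrier G \<Longrightarrow> B ** A = mat 1 \<Longrightarrow> inv\<^bsub>G\<^esub> A = B"
  using group.inv_equality[OF group_G, of B A] by simp

lemma inv_generators:
  "inv\<^bsub>G\<^esub> S = mat2 0 1 (-1) 0" "inv\<^bsub>G\<^esub> T = mat2 1 (-1) 0 1"
  by (rule inv_eqI; simp add: SL2Z_subset mat2_eq_iff S_def T_def)+

lemma inv_P: "P \<in> carrier G \<Longrightarrow> inv\<^bsub>G\<^esub> P = P"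
  by (rule inv_eqI) (simp_all add: mat2_eq_iff P_def)

lemma cocycle_mult:
  assumes "f \<in> carrier (char_Z1 G (*v))" "A \<in> carrier G" "B \<in> carrier G"
  shows "f (A ** B) x = f A x * f B (inv\<^bsub>G\<^esub> A *v x)"
  using assms by (auto simp: mem_char_Z1 simp del: mat2_vec_nth)

lemma cocycle_char:
  assumes "f \<in> carrier (char_Z1 G (*v))" "A \<in> carrier G"
  shows "f A \<in> carrier char_group"
  using assms by (auto simp: mem_char_Z1)

lemma cocycle_nonzero:
  assumes "f \<in> carrier (char_Z1 G (*v))" "A \<in> carrier G"
  shows "f A x \<noteq> 0"
  using cocycle_char[OF assms] by (simp add: mem_char_group)

lemma cocycle_one:
  assumes "f \<in> carrier (char_Z1 G (*v))"
  shows "f (mat 1) x = 1"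
proof -
  have one: "mat 1 \<in> carrier G" by (simp add: SL2Z_subset)
  have "inv\<^bsub>G\<^esub> (mat 1) = mat 1" by (rule inv_eqI) (simp_all add: one)
  then show ?thesis using cocycle_mult[OF assms one one, of x] cocycle_nonzero[OF assms one] by simp
qed

text \<open>Evaluate \<open>S = TSTST\<close> at both basis vectors.\<close>

lemma cocycle_relations:
  fixes f :: "int^2^2 \<Rightarrow> int^2 \<Rightarrow> 'k::field"
  assumes f: "f \<in> carrier (char_Z1 G (*v))"
  shows "f S e\<^sub>1 = f S e\<^sub>2 * f T e\<^sub>2 ^ 2" "f T e\<^sub>1 ^ 2 = 1"
proof -
  have in_G: "S \<in> carrier G" "T \<in> carrier G" by (simp_all add: SL2Z_subset)
  note closed = in_G mult_in_G
  define a b c d where "a = f S e\<^sub>1" "b = f S e\<^sub>2" "c = f T e\<^sub>1" "d = f T e\<^sub>2"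
  note abcd = this
  have nz: "a \<noteq> 0" "b \<noteq> 0" "c \<noteq> 0" "d \<noteq> 0"
    unfolding abcd by (simp_all add: cocycle_nonzero[OF f] in_G)
  have fS: "f S x = a powi (x $ 1) * b powi (x $ 2)" and fT: "f T x = c powi (x $ 1) * d powi (x $ 2)" for x
    unfolding abcd by (rule char_eval[OF cocycle_char[OF f]]; simp add: in_G)+
  \<comment> \<open>This is (ST)^3 = S^2 with one factor S cancelled on the left.\<close>
  have "S = T ** (S ** (T ** (S ** T)))" by (simp add: mat2_eq_iff S_def T_def)
  then have "f S x = f (T ** (S ** (T ** (S ** T)))) x" for x by simp
  also have "\<dots> x = f T x * (f S (inv\<^bsub>G\<^esub> T *v x) * (f T (inv\<^bsub>G\<^esub> S *v (inv\<^bsub>G\<^esub> T *v x))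
      * (f S (inv\<^bsub>G\<^esub> T *v (inv\<^bsub>G\<^esub> S *v (inv\<^bsub>G\<^esub> T *v x)))
      * f T (inv\<^bsub>G\<^esub> S *v (inv\<^bsub>G\<^esub> T *v (inv\<^bsub>G\<^esub> S *v (inv\<^bsub>G\<^esub> T *v x)))))))" for x
    by (simp only: cocycle_mult[OF f] closed)
  finally have rel: "f S x = \<dots> x" for x .
  have "a = c * (a * (inverse d * (a * inverse b * (inverse c * inverse d))))"
    using rel[of e\<^sub>1] unfolding fS fT inv_generators by (simp add: power_int_minus)
  then have 1: "a = b * d ^ 2" using nz by (simp add: field_simps power2_eq_square)
  have "b = d * (inverse a * b * (c * d * (b * c)))"
    using rel[of e\<^sub>2] unfolding fS fT inv_generators by (simp add: power_int_minus)
  then have "a = b * d ^ 2 * c ^ 2" using nz by (simp add: field_simps power2_eq_square)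
  with 1 nz have "c ^ 2 = 1" by simp
  with 1 show "f S e\<^sub>1 = f S e\<^sub>2 * f T e\<^sub>2 ^ 2" "f T e\<^sub>1 ^ 2 = 1" by (simp_all add: abcd)
qed

text \<open>The equivalence has the shape that \<open>SL2Z_induct\<close> asks for. To recover the
  value at \<open>B\<close>, the cocycle identity is read at \<open>A *v x\<close>, where the
  inverse of \<open>A\<close> cancels.\<close>

lemma cocycle_mult_cong_iff:
  assumes f: "f \<in> carrier (char_Z1 G (*v))" and f': "f' \<in> carrier (char_Z1 G (*v))"
    and "A \<in> carrier G" "B \<in> carrier G" "f A = f' A"
  shows "f (A ** B) = f' (A ** B) \<longleftrightarrow> f B = f' B"
proof
  assume eq: "f (A ** B) = f' (A ** B)"
  show "f B = f' B"
  proof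
    fix x
    have "f A (A *v x) * f B x = f' A (A *v x) * f' B x"
      using fun_cong[OF eq, of "A *v x"] by (simp only: cocycle_mult[OF f] cocycle_mult[OF f'] assms(3,4) inv_G_vec)
    then show "f B x = f' B x" using cocycle_nonzero[OF f' assms(3)] assms(5) by simp
  qed
next
  assume "f B = f' B"
  then show "f (A ** B) = f' (A ** B)"
    by (intro ext) (simp only: cocycle_mult[OF f] cocycle_mult[OF f'] assms(3-5))
qed

lemma cocycle_eqI:
  fixes f f' :: "int^2^2 \<Rightarrow> int^2 \<Rightarrow> 'k::field"
  assumes f: "f \<in> carrier (char_Z1 G (*v))" and f': "f' \<in> carrier (char_Z1 G (*v))"
    and eq: "f S e\<^sub>2 = f' S e\<^sub>2" "f T e\<^sub>1 = f' T e\<^sub>1" "f T e\<^sub>2 = f' T e\<^sub>2"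
  shows "f = f'"
proof -
  have in_G: "S \<in> carrier G" "T \<in> carrier G" by (simp_all add: SL2Z_subset)
  have S: "f S = f' S"
    using eq by (intro char_eqI cocycle_char f f' in_G) (simp_all add: cocycle_relations(1)[OF f] cocycle_relations(1)[OF f'])
  have T: "f T = f' T"
    using eq by (intro char_eqI cocycle_char f f' in_G)
  have SL: "f A = f' A" if "det A = 1" for A
  proof (rule SL2Z_induct[OF that, where Q = "\<lambda>A. f A = f' A"])
    show "f (mat 1) = f' (mat 1)" by (intro ext) (simp add: cocycle_one[OF f] cocycle_one[OF f'])
  qed (rule cocycle_mult_cong_iff[OF f f']; simp add: S T in_G SL2Z_subset)+
  have "f A = f' A" if A: "A \<in> carrier G" "det A = -1" for A
  proof -
    have P: "P \<in> carrier G" using A by (rule P_in_G)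
    \<comment> \<open>The matrix \<open>P ** (T ** P)\<close> has determinant 1, so the cocycle is
      already determined there. In its value at \<open>e\<^sub>1\<close> the two contributions of
      \<open>g P e\<^sub>1\<close> cancel, which determines \<open>g P e\<^sub>2\<close>; then
      \<open>P ** P = mat 1\<close> determines \<open>g P e\<^sub>1\<close>.\<close>
    have swap: "g P e\<^sub>2 * g T e\<^sub>2 = g (P ** (T ** P)) e\<^sub>1" "g P e\<^sub>1 * g P e\<^sub>2 = 1"
      if g: "g \<in> carrier (char_Z1 G (*v))" for g :: "int^2^2 \<Rightarrow> int^2 \<Rightarrow> 'k"
    proof -
      have vec: "inv\<^bsub>G\<^esub> P *v e\<^sub>1 = e\<^sub>2" "inv\<^bsub>G\<^esub> T *v e\<^sub>2 = vector [-1, 1]"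
        unfolding inv_P[OF P] inv_generators by (simp_all add: vec_eq_iff forall_2 P_def)
      have "P ** P = mat 1" by (simp add: mat2_eq_iff P_def)
      then show *: "g P e\<^sub>1 * g P e\<^sub>2 = 1"
        using cocycle_mult[OF g P P, of e\<^sub>1] cocycle_one[OF g, of e\<^sub>1] by (simp only: vec)
      have "g P (vector [-1, 1]) = inverse (g P e\<^sub>1) * g P e\<^sub>2"
        by (subst char_eval[OF cocycle_char[OF g P]]) (simp add: power_int_minus)
      then have "g (P ** (T ** P)) e\<^sub>1 = g P e\<^sub>1 * (g T e\<^sub>2 * (inverse (g P e\<^sub>1) * g P e\<^sub>2))"
        by (simp only: cocycle_mult[OF g] P in_G mult_in_G vec)
      then show "g P e\<^sub>2 * g T e\<^sub>2 = g (P ** (T ** P)) e\<^sub>1"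
        using cocycle_nonzero[OF g P, of e\<^sub>1] by simp
    qed
    have "f (P ** (T ** P)) = f' (P ** (T ** P))" by (rule SL) (simp add: det_mul)
    then have 2: "f P e\<^sub>2 = f' P e\<^sub>2"
      using swap(1)[OF f] swap(1)[OF f'] eq(3) cocycle_nonzero[OF f' in_G(2), of e\<^sub>2] by (metis mult_cancel_right)
    then have "f P e\<^sub>1 = f' P e\<^sub>1"
      using swap(2)[OF f] swap(2)[OF f'] by (metis mult_cancel_right mult_zero_right zero_neq_one)
    then have "f P = f' P"
      using 2 by (intro char_eqI cocycle_char f f' P)
    moreover have "A = P ** (P ** A)" by (simp add: mat2_eq_iff P_def)
    moreover have "f (P ** A) = f' (P ** A)" using A by (intro SL) (simp add: det_mul)
    ultimately show ?thesis
      using cocycle_mult_cong_iff[OF f f' P mult_in_G[OF P A(1)]] by simp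
  qed
  with SL det_G have "f A = f' A" if "A \<in> carrier G" for A using that by blast
  then show ?thesis
    using f f' by (intro extensionalityI[of _ "carrier G"]) (simp_all add: mem_char_Z1 PiE_def)
qed

text \<open>The coboundary of theta times the sign cocycle. The values of theta solve for the
  prescribed parameters: the value d at \<open>T\<close>, \<open>e\<^sub>2\<close> forces z / d at
  \<open>e\<^sub>1\<close>, because \<open>hex_exp\<close> contributes a factor z, and the value b
  at \<open>S\<close>, \<open>e\<^sub>2\<close> then forces z^2 / (b d) = 1 / (b d) at
  \<open>e\<^sub>2\<close>. No roots have to be extracted. Since \<open>T\<close> fixes
  \<open>e\<^sub>1\<close>, the coboundary is trivial there and the sign cocycle alone gives
  z.\<close>

definition param_cocycle :: "'k::field \<Rightarrow> 'k \<Rightarrow> 'k \<Rightarrow> int^2^2 \<Rightarrow> int^2 \<Rightarrow> 'k" where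
  "param_cocycle b d z =
    (let \<theta> = (\<lambda>x::int^2. (z / d) powi (x $ 1) * (1 / (b * d)) powi (x $ 2))
     in (\<lambda>A\<in>carrier G. (\<lambda>x. \<theta> (inv\<^bsub>G\<^esub> A *v x) / \<theta> x * z powi hex_exp (inv\<^bsub>G\<^esub> A) x)))"

lemma param_cocycle:
  fixes b d z :: "'k::field"
  assumes "b \<noteq> 0" "d \<noteq> 0" "z ^ 2 = 1"
  defines "f \<equiv> param_cocycle b d z"
  shows "f \<in> carrier (char_Z1 G (*v))" "f S e\<^sub>2 = b" "f T e\<^sub>1 = z" "f T e\<^sub>2 = d"
proof -
  have z: "z \<noteq> 0" "z * z = 1" using assms by (auto simp: power2_eq_square)
  define \<theta> where "\<theta> = (\<lambda>x::int^2. (z / d) powi (x $ 1) * (1 / (b * d)) powi (x $ 2))"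
  have \<theta>: "\<theta> x \<noteq> 0" "\<theta> (x + y) = \<theta> x * \<theta> y" for x y
    using assms z by (simp_all add: \<theta>_def power_int_add)
  have f_eq: "f A x = \<theta> (inv\<^bsub>G\<^esub> A *v x) / \<theta> x * z powi hex_exp (inv\<^bsub>G\<^esub> A) x" if "A \<in> carrier G" for A x
    using that by (simp add: f_def param_cocycle_def \<theta>_def del: mat2_vec_nth)
  have odd: "odd (det (inv\<^bsub>G\<^esub> A))" if "A \<in> carrier G" for A
    using det_G[OF inv_in_G[OF that]] by auto
  have char: "f A \<in> carrier char_group" if A: "A \<in> carrier G" for A
  proof -
    have "z powi hex_exp (inv\<^bsub>G\<^esub> A) (x + y) = z powi hex_exp (inv\<^bsub>G\<^esub> A) x * z powi hex_exp (inv\<^bsub>G\<^esub> A) y" for x y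
      using powi_cong_even[OF assms(3) hex_exp_add[OF odd[OF A]]] z by (simp add: power_int_add)
    then show ?thesis
      using z by (simp add: mem_char_group f_eq[OF A] \<theta> matrix_vector_right_distrib del: mat2_vec_nth)
  qed
  have mult: "f (A ** B) x = f A x * f B (inv\<^bsub>G\<^esub> A *v x)" if AB: "A \<in> carrier G" "B \<in> carrier G" for A B x
  proof -
    have inv: "inv\<^bsub>G\<^esub> (A ** B) = inv\<^bsub>G\<^esub> B ** inv\<^bsub>G\<^esub> A"
      using group.inv_mult_group[OF group_G AB] by simp
    have "z powi hex_exp (inv\<^bsub>G\<^esub> (A ** B)) x =
        z powi hex_exp (inv\<^bsub>G\<^esub> A) x * z powi hex_exp (inv\<^bsub>G\<^esub> B) (inv\<^bsub>G\<^esub> A *v x)"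
      using powi_cong_even[OF assms(3) hex_exp_mult[OF odd[OF AB(1)] odd[OF AB(2)]], of x] z
      by (simp add: inv power_int_add del: mat2_vec_nth)
    moreover have "inv\<^bsub>G\<^esub> (A ** B) *v x = inv\<^bsub>G\<^esub> B *v (inv\<^bsub>G\<^esub> A *v x)"
      by (simp only: inv matrix_vector_mul_assoc)
    ultimately show ?thesis
      using AB by (simp add: f_eq mult_in_G \<theta> del: mat2_vec_nth)
  qed
  show "f \<in> carrier (char_Z1 G (*v))"
    using char mult by (auto simp: mem_char_Z1 fun_eq_iff f_def param_cocycle_def Let_def simp del: mat2_vec_nth)
  have in_G: "S \<in> carrier G" "T \<in> carrier G" by (simp_all add: SL2Z_subset)
  show "f S e\<^sub>2 = b"
    unfolding f_eq[OF in_G(1)] inv_generators hex_exp_values using assms z by (simp add: \<theta>_def)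
  show "f T e\<^sub>1 = z"
    unfolding f_eq[OF in_G(2)] inv_generators hex_exp_values using assms z by (simp add: \<theta>_def)
  show "f T e\<^sub>2 = d"
    unfolding f_eq[OF in_G(2)] inv_generators hex_exp_values using assms z
    by (simp add: \<theta>_def power_int_minus)
qed

lemma char_Z1_iso_SL_params:
  "(char_Z1 G (*v) :: (int^2^2 \<Rightarrow> int^2 \<Rightarrow> 'k) monoid) \<cong> (SL_params :: (('k::field \<times> 'k) \<times> 'k) monoid)"
proof (rule is_isoI)
  let ?Z = "char_Z1 G (*v) :: (int^2^2 \<Rightarrow> int^2 \<Rightarrow> 'k) monoid"
  let ?h = "\<lambda>f :: int^2^2 \<Rightarrow> int^2 \<Rightarrow> 'k. ((f S e\<^sub>2, f T e\<^sub>2), f T e\<^sub>1)"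
  have in_G: "S \<in> carrier G" "T \<in> carrier G" by (simp_all add: SL2Z_subset)
  have closed: "?h f \<in> carrier SL_params" if "f \<in> carrier ?Z" for f
    using cocycle_nonzero[OF that] cocycle_relations(2)[OF that] in_G by simp
  have "?h \<in> hom ?Z SL_params"
    by (rule homI) (use closed in_G in \<open>simp_all add: char_Z1_def Z1_def char_group_def\<close>)
  moreover have "inj_on ?h (carrier ?Z)"
    by (rule inj_onI, rule cocycle_eqI) auto
  moreover have "?h ` carrier ?Z = carrier SL_params"
  proof (intro equalityI subsetI)
    fix p :: "('k \<times> 'k) \<times> 'k" assume p: "p \<in> carrier SL_params"
    obtain b d z where "p = ((b, d), z)" by (metis surj_pair)
    with p param_cocycle[of b d z] show "p \<in> ?h ` carrier ?Z"
      by (intro image_eqI[of _ _ "param_cocycle b d z"]) auto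
  qed (use closed in blast)
  ultimately show "?h \<in> iso ?Z SL_params" by (simp add: iso_iff)
qed

end

text \<open>Existence of a splitting is asserted once, over \<open>Aut_lam q\<close>. Composed with
  the isomorphism from the matrix group it provides a base splitting over that group, so the
  quantification over \<open>\<sigma>\<^sub>0\<close> is not vacuous.\<close>

theorem mainTheorem2:
  fixes q :: "'k::field"
  assumes "q \<noteq> 0"
  shows
    "short_exact char_group (Aut_qt q) (Aut_lam q) char_aut lattice_part \<and>
     splittings q (Aut_lam q) (\<lambda>\<psi>. \<psi>) \<noteq> {} \<and>
     (q ^ 2 = 1 \<longrightarrow>
        (*v) \<in> iso GL2Z (Aut_lam q) \<and>
        (\<forall>\<sigma>\<^sub>0 \<in> splittings q GL2Z (*v).
           bij_betw (\<lambda>f. twist q GL2Z f \<sigma>\<^sub>0)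
             (carrier (char_Z1 GL2Z (*v))) (splittings q GL2Z (*v))) \<and>
        comm_group (char_Z1 GL2Z (*v) :: (int^2^2 \<Rightarrow> int^2 \<Rightarrow> 'k) monoid) \<and>
        (char_Z1 GL2Z (*v) :: (int^2^2 \<Rightarrow> int^2 \<Rightarrow> 'k) monoid) \<cong> (GL_params :: ('k \<times> 'k \<times> 'k) monoid)) \<and>
     (q ^ 2 \<noteq> 1 \<longrightarrow>
        (*v) \<in> iso SL2Z (Aut_lam q) \<and>
        (\<forall>\<sigma>\<^sub>0 \<in> splittings q SL2Z (*v).
           bij_betw (\<lambda>f. twist q SL2Z f \<sigma>\<^sub>0)
             (carrier (char_Z1 SL2Z (*v))) (splittings q SL2Z (*v))) \<and>
        comm_group (char_Z1 SL2Z (*v) :: (int^2^2 \<Rightarrow> int^2 \<Rightarrow> 'k) monoid) \<and>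
        (char_Z1 SL2Z (*v) :: (int^2^2 \<Rightarrow> int^2 \<Rightarrow> 'k) monoid) \<cong> (SL_params :: (('k \<times> 'k) \<times> 'k) monoid))"
proof (intro conjI impI ballI)
  interpret GL: lattice_matrix_group GL2Z by standard simp
  interpret SL: lattice_matrix_group SL2Z by standard simp
  show "short_exact char_group (Aut_qt q) (Aut_lam q) char_aut lattice_part"
    using assms by (rule short_exact_Aut_qt)
  show "splittings q (Aut_lam q) (\<lambda>\<psi>. \<psi>) \<noteq> {}"
    using split_aut_splitting[OF assms] by blast
  show "comm_group (char_Z1 GL2Z (*v) :: (int^2^2 \<Rightarrow> int^2 \<Rightarrow> 'k) monoid)"
    "comm_group (char_Z1 SL2Z (*v) :: (int^2^2 \<Rightarrow> int^2 \<Rightarrow> 'k) monoid)"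
    using group_GL2Z group_SL2Z by (simp_all add: comm_group_char_Z1)
  show "(char_Z1 SL2Z (*v) :: (int^2^2 \<Rightarrow> int^2 \<Rightarrow> 'k) monoid) \<cong> (SL_params :: (('k \<times> 'k) \<times> 'k) monoid)"
    by (rule SL.char_Z1_iso_SL_params)
  show "(char_Z1 GL2Z (*v) :: (int^2^2 \<Rightarrow> int^2 \<Rightarrow> 'k) monoid) \<cong> (GL_params :: ('k \<times> 'k \<times> 'k) monoid)"
    by (rule iso_trans[OF GL.char_Z1_iso_SL_params SL_params_iso_GL_params])
  {
    assume "q ^ 2 = 1"
    then show iso: "(*v) \<in> iso GL2Z (Aut_lam q)" using assms by (intro mat2_iso_Aut_lam) auto
    fix \<sigma>\<^sub>0 assume "\<sigma>\<^sub>0 \<in> splittings q GL2Z (*v)"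
    with iso show "bij_betw (\<lambda>f. twist q GL2Z f \<sigma>\<^sub>0) (carrier (char_Z1 GL2Z (*v))) (splittings q GL2Z (*v))"
      by (intro twist_bij[OF assms group_GL2Z]) (simp_all add: iso_def)
  }
  {
    assume "q ^ 2 \<noteq> 1"
    then show iso: "(*v) \<in> iso SL2Z (Aut_lam q)" using assms by (intro mat2_iso_Aut_lam) auto
    fix \<sigma>\<^sub>0 assume "\<sigma>\<^sub>0 \<in> splittings q SL2Z (*v)"
    with iso show "bij_betw (\<lambda>f. twist q SL2Z f \<sigma>\<^sub>0) (carrier (char_Z1 SL2Z (*v))) (splittings q SL2Z (*v))"
      by (intro twist_bij[OF assms group_SL2Z]) (simp_all add: iso_def)
  }
qed

end
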